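(* Consider the mean-spherical 120$^\circ$-model on $\mathbb T_L$ with Hamiltonian $\mathscr H_L$ and constraint term $\mathscr N_L$ as below, and let $\langle-\rangle_{L,\beta,\mu}$ be the expectation with respect to the probability measure on $(\mathbb R^2)^{\mathbb T_L}$ with density proportional to $e^{-\beta\mathscr H_L-\mu\mathscr N_L}$. There exists a positive real-analytic function $\mu_\star:(0,\infty)\to(0,\infty)$ such that for each $\beta\in(0,\infty)$, with $\mu=\mu_\star(\beta)$: (i) $\lim_{L\to\infty}L^{-3}\langle\mathscr N_L\rangle_{L,\beta,\mu_\star(\beta)}=1$; (ii) $\lim_{L\to\infty}\bigl\langle|L^{-3}\sum_{\boldsymbol r\in\mathbb T_L}\boldsymbol S_{\boldsymbol r}|^2\bigr\rangle_{L,\beta,\mu_\star(\beta)}=0$; (iii) for all $\alpha,\alpha'\in\{x,y\}$, $\lim_{|\boldsymbol r-\boldsymbol r'|\to\infty}\lim_{L\to\infty}\langle S^{(\alpha)}_{\boldsymbol r}S^{(\alpha')}_{\boldsymbol r'}\rangle_{L,\beta,\mu_\star(\beta)}=0$. Moreover, the limiting free energy $\beta\mapsto\lim_{L\to\infty}L^{-3}\log Z_L(\beta,\mu_\star(\beta))$ is a real-analytic function of $\beta\in(0,\infty)$, where $Z_L(\beta,\mu)=\int_{(\mathbb R^2)^{\mathbb T_L}}e^{-\beta\mathscr H_L-\mu\mathscr N_L}\prod d\boldsymbol S_{\boldsymbol r}$.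
   Context: Here $\boldsymbol S_{\boldsymbol r}=(S^{(x)}_{\boldsymbol r},S^{(y)}_{\boldsymbol r})\in\mathbb R^2$ are unrestricted, with a priori Lebesgue measure. With $\hat{\mathrm a}=(1,0)$, $\hat{\mathrm b}=(-\tfrac12,\tfrac{\sqrt3}2)$, $\hat{\mathrm c}=(-\tfrac12,-\tfrac{\sqrt3}2)$, $J>0$, the Hamiltonian on $\mathbb T_L=\mathbb Z^3/(L\mathbb Z)^3$ is $\mathscr H_L=\frac J2\sum_{\boldsymbol r\in\mathbb T_L}\bigl[(\boldsymbol S_{\boldsymbol r}\cdot\hat{\mathrm a}-\boldsymbol S_{\boldsymbol r+\hat{\mathrm e}_x}\cdot\hat{\mathrm a})^2+(\boldsymbol S_{\boldsymbol r}\cdot\hat{\mathrm b}-\boldsymbol S_{\boldsymbol r+\hat{\mathrm e}_y}\cdot\hat{\mathrm b})^2+(\boldsymbol S_{\boldsymbol r}\cdot\hat{\mathrm c}-\boldsymbol S_{\boldsymbol r+\hat{\mathrm e}_z}\cdot\hat{\mathrm c})^2\bigr]$, and $\mathscr N_L=\sum_{\boldsymbol r\in\mathbb T_L}\bigl((S^{(x)}_{\boldsymbol r})^2+(S^{(y)}_{\boldsymbol r})^2\bigr)$. *)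

theory Defs
  imports "HOL-Analysis.Analysis"
begin

text \<open>Sites of the torus T_L = (Z/LZ)^3, represented by coordinates in {0..<L}.\<close>
type_synonym site = "nat \<times> nat \<times> nat"
type_synonym config = "site \<Rightarrow> real \<times> real"

definition sites :: "nat \<Rightarrow> site set" where
  "sites L = {0..<L} \<times> {0..<L} \<times> {0..<L}"

definition shift_x :: "nat \<Rightarrow> site \<Rightarrow> site" where
  "shift_x L r = (case r of (x, y, z) \<Rightarrow> ((x + 1) mod L, y, z))"
definition shift_y :: "nat \<Rightarrow> site \<Rightarrow> site" where
  "shift_y L r = (case r of (x, y, z) \<Rightarrow> (x, (y + 1) mod L, z))"
definition shift_z :: "nat \<Rightarrow> site \<Rightarrow> site" where
  "shift_z L r = (case r of (x, y, z) \<Rightarrow> (x, y, (z + 1) mod L))"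

definition site_of :: "nat \<Rightarrow> int \<times> int \<times> int \<Rightarrow> site" where
  "site_of L r = (case r of (a, b, c) \<Rightarrow>
     (nat (a mod int L), nat (b mod int L), nat (c mod int L)))"

definition euclid_dist3 :: "int \<times> int \<times> int \<Rightarrow> int \<times> int \<times> int \<Rightarrow> real" where
  "euclid_dist3 r r' = (case r of (a, b, c) \<Rightarrow> case r' of (a', b', c') \<Rightarrow>
     sqrt (real_of_int ((a - a')^2 + (b - b')^2 + (c - c')^2)))"

definition vec_a :: "real \<times> real" where "vec_a = (1, 0)"
definition vec_b :: "real \<times> real" where "vec_b = (-1/2, sqrt 3 / 2)"
definition vec_c :: "real \<times> real" where "vec_c = (-1/2, - sqrt 3 / 2)"

definition hamiltonian :: "real \<Rightarrow> nat \<Rightarrow> config \<Rightarrow> real" where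
  "hamiltonian J L S = J / 2 * (\<Sum>r\<in>sites L.
      (S r \<bullet> vec_a - S (shift_x L r) \<bullet> vec_a)^2
    + (S r \<bullet> vec_b - S (shift_y L r) \<bullet> vec_b)^2
    + (S r \<bullet> vec_c - S (shift_z L r) \<bullet> vec_c)^2)"

definition constraint :: "nat \<Rightarrow> config \<Rightarrow> real" where
  "constraint L S = (\<Sum>r\<in>sites L. (fst (S r))^2 + (snd (S r))^2)"

definition config_measure :: "nat \<Rightarrow> config measure" where
  "config_measure L = PiM (sites L) (\<lambda>_. lborel)"

definition gibbs_weight :: "real \<Rightarrow> nat \<Rightarrow> real \<Rightarrow> real \<Rightarrow> config \<Rightarrow> real" where
  "gibbs_weight J L \<beta> \<mu> S = exp (- \<beta> * hamiltonian J L S - \<mu> * constraint L S)"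

definition partition_fn :: "real \<Rightarrow> nat \<Rightarrow> real \<Rightarrow> real \<Rightarrow> real" where
  "partition_fn J L \<beta> \<mu> = (\<integral>S. gibbs_weight J L \<beta> \<mu> S \<partial>config_measure L)"

definition gibbs_expect :: "real \<Rightarrow> nat \<Rightarrow> real \<Rightarrow> real \<Rightarrow> (config \<Rightarrow> real) \<Rightarrow> real" where
  "gibbs_expect J L \<beta> \<mu> f =
     (\<integral>S. f S * gibbs_weight J L \<beta> \<mu> S \<partial>config_measure L) / partition_fn J L \<beta> \<mu>"

definition real_analytic_on :: "(real \<Rightarrow> real) \<Rightarrow> real set \<Rightarrow> bool" where
  "real_analytic_on f A \<longleftrightarrow> (\<forall>x\<in>A. \<exists>\<rho>>0. \<exists>a::nat \<Rightarrow> real.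
     \<forall>y. \<bar>y - x\<bar> < \<rho> \<longrightarrow> (\<lambda>n. a n * (y - x)^n) sums f y)"

end

theory Submission
  imports Defs "HOL-Probability.Distributions" "HOL-Complex_Analysis.Conformal_Mappings"
    "HOL-Real_Asymp.Real_Asymp"
begin

text \<open>
  With \<open>\<kappa> = \<beta> J\<close> and \<open>\<tau> = 2 \<mu>\<close> the weight is \<open>exp (- Q(S, S) / 2)\<close>, where \<open>Q\<close> is the form of
  \<open>T - \<kappa> B\<close> with \<open>T = 6 \<kappa> + \<tau>\<close> and \<open>B\<close> a translation invariant nearest-neighbour operator with
  \<open>0 \<le> B \<le> 6\<close>. Hence the covariance is the Neumann series \<open>\<Sum>n. v^n B^n / T\<close> in the hopping
  parameter \<open>v = \<kappa> / T < 1/6\<close>. The matrix elements of \<open>B^n\<close> on the torus agree with those on \<open>\<int>^3\<close>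
  as soon as \<open>L\<close> exceeds \<open>n\<close> plus the distance, and they vanish beyond distance \<open>n\<close>; dominated
  convergence then gives all the limits and the exponential decay of correlations.

  Let \<open>m n\<close> be the trace of the diagonal block of \<open>B^n\<close>. The limiting constraint is
  \<open>spin_density v / \<kappa>\<close> with \<open>spin_density v = \<Sum>n. m n v^(n+1)\<close>, a power series with nonnegative
  coefficients, so \<open>\<mu>\<^sub>s\<close> comes from solving \<open>spin_density v = \<kappa>\<close>. A solution exists for every \<open>\<kappa>\<close>
  because \<open>spin_density\<close> is unbounded on \<open>(0, 1/6)\<close>: a field supported on a lattice plane and
  orthogonal to the coupling direction normal to that plane only feels a two-dimensional Dirichlet
  energy, and the plane is recurrent. The solution is analytic by the holomorphic inverse function
  theorem. The free energy is \<open>ln (2 \<pi>) - ln T + (\<Sum>n. m n v^n / n) / 2\<close>, where the sum runs over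
  \<open>n \<ge> 1\<close>, obtained by integrating its \<open>\<tau>\<close>-derivative, which is minus half the mean constraint per
  site, from \<open>\<tau> = \<infinity>\<close>.
\<close>

section \<open>Real analysis\<close>

lemma square_le_mult_of_quadratic_nonneg:
  fixes a b c :: real
  assumes "c \<ge> 0" and nonneg: "\<And>s. a + 2 * s * b + s\<^sup>2 * c \<ge> 0"
  shows "b\<^sup>2 \<le> a * c"
proof (cases "c = 0")
  case True
  have "b = 0"
  proof (rule ccontr)
    assume "b \<noteq> 0"
    with nonneg[of "- (a + 1) / (2 * b)"] True show False by (simp add: field_simps)
  qed
  with True show ?thesis by simp
next
  case False
  then have "a - b\<^sup>2 / c \<ge> 0"
    using nonneg[of "- b / c"] by (simp add: power2_eq_square field_simps)
  with False assms(1) show ?thesis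
    by (simp add: divide_le_eq)
qed

lemma DERIV_of_supporting_lines:
  fixes G g :: "real \<Rightarrow> real"
  assumes "open S" "x \<in> S" and support: "\<And>x y. x \<in> S \<Longrightarrow> y \<in> S \<Longrightarrow> g x * (y - x) \<le> G y - G x"
    and continuous: "isCont g x"
  shows "(G has_real_derivative g x) (at x)"
proof -
  have "\<bar>(G y - G x) / (y - x) - g x\<bar> \<le> \<bar>g y - g x\<bar>" if y: "y \<in> S - {x}" for y
  proof -
    have "g x * (y - x) \<le> G y - G x" "G y - G x \<le> g y * (y - x)"
      using support[of x y] support[of y x] y assms(2) by (auto simp: algebra_simps)
    then have "g x \<le> (G y - G x) / (y - x) \<and> (G y - G x) / (y - x) \<le> g y
        \<or> g y \<le> (G y - G x) / (y - x) \<and> (G y - G x) / (y - x) \<le> g x"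
      using y by (cases "y > x")
        (simp_all add: pos_le_divide_eq pos_divide_le_eq neg_le_divide_eq neg_divide_le_eq not_less)
    then show ?thesis by linarith
  qed
  moreover have "\<forall>\<^sub>F y in at x. y \<in> S - {x}"
    using assms(1,2) by (rule eventually_at_in_open)
  ultimately have "\<forall>\<^sub>F y in at x. norm ((G y - G x) / (y - x) - g x) \<le> norm (g y - g x)"
    by (auto elim: eventually_mono)
  moreover have "(\<lambda>y. g y - g x) \<midarrow>x\<rightarrow> 0"
    using continuous by (simp add: isCont_def LIM_zero)
  ultimately have "(\<lambda>y. (G y - G x) / (y - x) - g x) \<midarrow>x\<rightarrow> 0"
    by (rule Lim_transform_bound)
  then show ?thesis
    unfolding has_field_derivative_iff by (rule LIM_zero_cancel)
qed

section \<open>Power series with geometrically bounded coefficients\<close>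

lemma fps_conv_radius_ge_geometric:
  fixes F :: "'a::{banach, real_normed_field} fps"
  assumes coeff: "\<And>n. norm (fps_nth F n) \<le> C * R ^ n" and "R > 0"
  shows "ereal (1 / R) \<le> fps_conv_radius F"
  unfolding fps_conv_radius_def
proof (rule conv_radius_geI_ex')
  fix r :: real assume r_range: "0 < r" "ereal r < ereal (1 / R)"
  show "summable (\<lambda>n. fps_nth F n * of_real r ^ n)"
  proof (rule summable_comparison_test')
    show "summable (\<lambda>n. C * (R * r) ^ n)"
      using r_range \<open>R > 0\<close> by (intro summable_mult summable_geometric) (simp add: field_simps)
    show "norm (fps_nth F n * of_real r ^ n) \<le> C * (R * r) ^ n" for n
      using mult_right_mono[OF coeff[of n], of "r ^ n"] r_range
      by (simp add: norm_mult norm_power power_mult_distrib)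
  qed
qed

lemma norm_eval_fps_le_geometric_tail:
  fixes F :: "'a::{banach, real_normed_field} fps"
  assumes coeff: "\<And>n. norm (fps_nth F n) \<le> C * R ^ n" and low: "\<And>n. n < N \<Longrightarrow> fps_nth F n = 0"
    and ratio: "R \<ge> 0" "R * norm z < 1"
  shows "norm (eval_fps F z) \<le> C * (R * norm z) ^ N / (1 - R * norm z)"
proof -
  let ?q = "R * norm z"
  have term_le: "norm (fps_nth F n * z ^ n) \<le> C * ?q ^ n" for n
    using mult_right_mono[OF coeff[of n], of "norm z ^ n"]
    by (simp add: norm_mult norm_power power_mult_distrib)
  have geometric: "(\<lambda>n. C * ?q ^ N * ?q ^ n) sums (C * ?q ^ N * (1 / (1 - ?q)))"
    using ratio by (intro sums_mult geometric_sums) simp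
  have "summable (\<lambda>n. fps_nth F n * z ^ n)"
    by (rule summable_comparison_test'[OF _ term_le])
       (use ratio in \<open>simp add: summable_mult summable_geometric\<close>)
  then have "eval_fps F z = (\<Sum>n. fps_nth F (n + N) * z ^ (n + N))"
    unfolding eval_fps_def by (subst suminf_split_initial_segment[where k = N]) (simp_all add: low)
  also have "norm \<dots> \<le> (\<Sum>n. C * ?q ^ N * ?q ^ n)"
    using term_le[of "_ + N"]
    by (intro norm_suminf_le sums_summable[OF geometric]) (simp add: power_add mult_ac)
  also have "\<dots> = C * ?q ^ N / (1 - ?q)"
    using sums_unique[OF geometric] by simp
  finally show ?thesis .
qed

lemma tendsto_eval_fps:
  fixes F :: "nat \<Rightarrow> 'a::{banach, real_normed_field} fps"
  assumes stable: "\<And>n. \<forall>\<^sub>F L in sequentially. fps_nth (F L) n = fps_nth G n"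
    and coeff: "\<And>L n. norm (fps_nth (F L) n) \<le> C * R ^ n" and ratio: "R \<ge> 0" "R * norm z < 1"
  shows "(\<lambda>L. eval_fps (F L) z) \<longlonglongrightarrow> eval_fps G z"
proof -
  have "(\<lambda>L. fps_nth (F L) n * z ^ n) \<longlonglongrightarrow> fps_nth G n * z ^ n" for n
    by (rule tendsto_eventually) (use stable[of n] in eventually_elim, simp)
  moreover have "norm (fps_nth (F L) n * z ^ n) \<le> C * (R * norm z) ^ n" for L n
    using mult_right_mono[OF coeff[of L n], of "norm z ^ n"]
    by (simp add: norm_mult norm_power power_mult_distrib)
  then have "\<forall>\<^sub>F (n, L) in at_top \<times>\<^sub>F sequentially. norm (fps_nth (F L) n * z ^ n)
      \<le> C * (R * norm z) ^ n"
    by (intro always_eventually) auto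
  moreover have "summable (\<lambda>n. C * (R * norm z) ^ n)"
    using ratio by (intro summable_mult summable_geometric) simp
  ultimately show ?thesis
    unfolding eval_fps_def
    by (intro tannerys_theorem[THEN conjunct2, THEN conjunct2]) auto
qed

lemma eval_fps_ge_nth_0:
  fixes F :: "real fps"
  assumes "\<And>n. fps_nth F n \<ge> 0" "0 \<le> x" "norm x < fps_conv_radius F"
  shows "fps_nth F 0 \<le> eval_fps F x"
  unfolding eval_fps_def
  using sum_le_suminf[OF summable_fps[OF assms(3)], of "{0}"] assms(1,2) by simp

section \<open>Real-analytic functions of one variable\<close>

definition real_analytic_at :: "(real \<Rightarrow> real) \<Rightarrow> real \<Rightarrow> bool" where
  "real_analytic_at f x \<longleftrightarrow>
     (\<exists>F. F analytic_on {complex_of_real x} \<and> (\<forall>\<^sub>F y in nhds x. F (of_real y) = of_real (f y)))"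

lemma real_analytic_atI:
  assumes "F analytic_on {complex_of_real x}" "\<forall>\<^sub>F y in nhds x. F (of_real y) = of_real (f y)"
  shows "real_analytic_at f x"
  using assms unfolding real_analytic_at_def by blast

lemma real_analytic_atE:
  assumes "real_analytic_at f x"
  obtains F where "F analytic_on {complex_of_real x}" "F (of_real x) = of_real (f x)"
    "\<forall>\<^sub>F y in nhds x. F (of_real y) = of_real (f y)"
  using assms eventually_nhds_x_imp_x unfolding real_analytic_at_def by blast

lemma real_analytic_on_if_at:
  assumes "\<And>x. x \<in> A \<Longrightarrow> real_analytic_at f x"
  shows "real_analytic_on f A"
  unfolding real_analytic_on_def
proof
  fix x assume "x \<in> A"
  then obtain F where F_analytic: "F analytic_on {complex_of_real x}"
    and extends: "\<forall>\<^sub>F y in nhds x. F (of_real y) = of_real (f y)"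
    using assms real_analytic_atE by metis
  obtain e where F_holomorphic: "e > 0" "F holomorphic_on ball (of_real x) e"
    using F_analytic by (auto simp: analytic_on_def)
  obtain d where F_extends: "d > 0" "\<And>y. dist y x < d \<Longrightarrow> F (of_real y) = of_real (f y)"
    using extends unfolding eventually_nhds_metric by blast
  define a where "a n = Re ((deriv ^^ n) F (of_real x) / fact n)" for n
  have "(\<lambda>n. a n * (y - x) ^ n) sums f y" if near: "\<bar>y - x\<bar> < min d e" for y
  proof -
    have "complex_of_real y \<in> ball (of_real x) e"
      using near by (simp add: dist_norm abs_minus_commute flip: of_real_diff)
    then have "(\<lambda>n. (deriv ^^ n) F (of_real x) / fact n * of_real ((y - x) ^ n)) sums F (of_real y)"
      using holomorphic_power_series[OF F_holomorphic(2)] by simp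
    then have "(\<lambda>n. Re ((deriv ^^ n) F (of_real x) / fact n * of_real ((y - x) ^ n)))
        sums Re (F (of_real y))"
      by (rule sums_Re)
    moreover have "Re (F (of_real y)) = f y"
      using F_extends(2)[of y] near by (simp add: dist_real_def)
    moreover have "Re (c * of_real t) = Re c * t" for c t
      by simp
    ultimately show ?thesis
      unfolding a_def by (simp only:)
  qed
  then show "\<exists>\<rho>>0. \<exists>a. \<forall>y. \<bar>y - x\<bar> < \<rho> \<longrightarrow> (\<lambda>n. a n * (y - x) ^ n) sums f y"
    using F_extends(1) F_holomorphic(1) by (intro exI[of _ "min d e"]) auto
qed

lemma real_analytic_at_imp_isCont:
  assumes "real_analytic_at f x"
  shows "isCont f x"
proof -
  obtain F where analytic: "F analytic_on {complex_of_real x}"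
    and extends: "\<forall>\<^sub>F y in nhds x. F (of_real y) = of_real (f y)"
    using assms real_analytic_atE by metis
  have "isCont (\<lambda>y. F (of_real y)) x"
    by (rule isCont_o2[where g = F and f = complex_of_real])
       (auto intro: analytic_at_imp_isCont[OF analytic])
  then have "isCont (\<lambda>y. Re (F (of_real y))) x"
    by (rule isCont_Re)
  moreover have "\<forall>\<^sub>F y in nhds x. Re (F (of_real y)) = f y"
    using extends by eventually_elim simp
  ultimately show ?thesis
    by (simp add: isCont_cong)
qed

lemma real_analytic_at_ident: "real_analytic_at (\<lambda>x. x) x"
  by (rule real_analytic_atI[of "\<lambda>z. z"]) (auto intro: analytic_intros)

lemma real_analytic_at_const: "real_analytic_at (\<lambda>_. c) x"
  by (rule real_analytic_atI[of "\<lambda>_. of_real c"]) (auto intro: analytic_intros)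

lemma real_analytic_at_binary:
  assumes f_analytic: "real_analytic_at f x" and g_analytic: "real_analytic_at g x"
    and analytic: "\<And>F G. F analytic_on {complex_of_real x} \<Longrightarrow> G analytic_on {complex_of_real x} \<Longrightarrow>
      G (of_real x) = of_real (g x) \<Longrightarrow> (\<lambda>z. H (F z) (G z)) analytic_on {complex_of_real x}"
    and extends: "\<And>a b. H (of_real a) (of_real b) = of_real (h a b)"
  shows "real_analytic_at (\<lambda>x. h (f x) (g x)) x"
proof -
  obtain F where F_ext: "F analytic_on {complex_of_real x}" "\<forall>\<^sub>F y in nhds x. F (of_real y) = of_real (f y)"
    using f_analytic real_analytic_atE by metis
  obtain G where G_ext: "G analytic_on {complex_of_real x}" "G (of_real x) = of_real (g x)"
      "\<forall>\<^sub>F y in nhds x. G (of_real y) = of_real (g y)"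
    using g_analytic real_analytic_atE by metis
  have "\<forall>\<^sub>F y in nhds x. H (F (of_real y)) (G (of_real y)) = of_real (h (f y) (g y))"
    using F_ext(2) G_ext(3) by eventually_elim (simp add: extends)
  with analytic[OF F_ext(1) G_ext(1,2)] show ?thesis
    by (rule real_analytic_atI)
qed

lemma real_analytic_at_add:
  "real_analytic_at f x \<Longrightarrow> real_analytic_at g x \<Longrightarrow> real_analytic_at (\<lambda>x. f x + g x) x"
  by (rule real_analytic_at_binary[where H = "(+)"]) (auto intro: analytic_intros)

lemma real_analytic_at_diff:
  "real_analytic_at f x \<Longrightarrow> real_analytic_at g x \<Longrightarrow> real_analytic_at (\<lambda>x. f x - g x) x"
  by (rule real_analytic_at_binary[where H = "(-)"]) (auto intro: analytic_intros)

lemma real_analytic_at_mult: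
  "real_analytic_at f x \<Longrightarrow> real_analytic_at g x \<Longrightarrow> real_analytic_at (\<lambda>x. f x * g x) x"
  by (rule real_analytic_at_binary[where H = "(*)"]) (auto intro: analytic_intros)

lemma real_analytic_at_divide:
  "real_analytic_at f x \<Longrightarrow> real_analytic_at g x \<Longrightarrow> g x \<noteq> 0 \<Longrightarrow> real_analytic_at (\<lambda>x. f x / g x) x"
  by (rule real_analytic_at_binary[where H = "(/)"]) (auto intro: analytic_on_divide)

lemma real_analytic_at_compose:
  assumes g_analytic: "real_analytic_at g x" and f_analytic: "real_analytic_at f (g x)"
  shows "real_analytic_at (\<lambda>x. f (g x)) x"
proof -
  obtain F where F_analytic: "F analytic_on {complex_of_real (g x)}"
    and F_extends: "\<forall>\<^sub>F y in nhds (g x). F (of_real y) = of_real (f y)"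
    using f_analytic real_analytic_atE by metis
  obtain G where G_analytic: "G analytic_on {complex_of_real x}" "G (of_real x) = of_real (g x)"
    and G_extends: "\<forall>\<^sub>F y in nhds x. G (of_real y) = of_real (g y)"
    using g_analytic real_analytic_atE by metis
  have "filterlim g (nhds (g x)) (nhds x)"
    using real_analytic_at_imp_isCont[OF g_analytic] by (simp add: isCont_def tendsto_at_iff_tendsto_nhds)
  with F_extends have "\<forall>\<^sub>F y in nhds x. F (of_real (g y)) = of_real (f (g y))"
    by (rule eventually_compose_filterlim)
  with G_extends have "\<forall>\<^sub>F y in nhds x. (F \<circ> G) (of_real y) = of_real (f (g y))"
    by eventually_elim simp
  moreover have "(F \<circ> G) analytic_on {of_real x}"
    using F_analytic G_analytic by (intro analytic_on_compose) auto
  ultimately show ?thesis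
    by (rule real_analytic_atI[rotated])
qed

lemma real_analytic_at_ln:
  assumes "x > 0"
  shows "real_analytic_at ln x"
proof (rule real_analytic_atI)
  have "Ln holomorphic_on - \<real>\<^sub>\<le>\<^sub>0"
    by (intro holomorphic_on_Ln) auto
  then have "Ln analytic_on - \<real>\<^sub>\<le>\<^sub>0"
    by (simp add: analytic_on_open open_Compl)
  then show "Ln analytic_on {complex_of_real x}"
    by (rule analytic_on_subset) (use assms in auto)
  have "\<forall>\<^sub>F y in nhds x. y \<in> {0<..}"
    using assms by (intro eventually_nhds_in_open) auto
  then show "\<forall>\<^sub>F y in nhds x. Ln (of_real y) = of_real (ln y)"
    by eventually_elim (simp add: Ln_of_real)
qed

lemma real_analytic_at_eval_fps:
  fixes F :: "real fps"
  assumes "norm x < fps_conv_radius F"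
  shows "real_analytic_at (eval_fps F) x"
proof (rule real_analytic_atI)
  define G where "G = Abs_fps (\<lambda>n. complex_of_real (fps_nth F n))"
  have radius: "fps_conv_radius G = fps_conv_radius F"
    using conv_radius_norm[of "fps_nth G"] conv_radius_norm[of "fps_nth F"]
    by (simp add: fps_conv_radius_def G_def)
  show "eval_fps G analytic_on {of_real x}"
    using assms by (intro analytic_on_eval_fps) (simp add: radius)
  have "\<forall>\<^sub>F y in nhds x. y \<in> eball 0 (fps_conv_radius F)"
    using assms by (intro eventually_nhds_in_open) auto
  then show "\<forall>\<^sub>F y in nhds x. eval_fps G (of_real y) = of_real (eval_fps F y)"
  proof eventually_elim
    case (elim y)
    then have "summable (\<lambda>n. fps_nth F n * y ^ n)"
      by (intro summable_fps) simp
    then show ?case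
      unfolding eval_fps_def by (subst suminf_of_real) (simp_all add: G_def)
  qed
qed

lemma deriv_complex_extension:
  assumes analytic: "F analytic_on {complex_of_real x}"
    and extends: "\<forall>\<^sub>F y in nhds x. F (of_real y) = of_real (f y)"
    and derivative: "(f has_real_derivative f') (at x)"
  shows "deriv F (of_real x) = of_real f'"
proof -
  have "(F has_field_derivative deriv F (of_real x)) (at (of_real x))"
    using analytic by (simp add: analytic_on_imp_differentiable_at DERIV_deriv_iff_field_differentiable)
  then have "((\<lambda>y. F (of_real y)) has_vector_derivative deriv F (of_real x)) (at x)"
    by (rule has_vector_derivative_real_field)
  moreover have "((\<lambda>y. F (of_real y)) has_vector_derivative of_real f') (at x)"
  proof (subst has_vector_derivative_cong_ev)
    show "\<forall>\<^sub>F y in nhds x. y \<in> UNIV \<longrightarrow> F (of_real y) = of_real (f y)"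
      using extends by simp
    show "((\<lambda>y. complex_of_real (f y)) has_vector_derivative of_real f') (at x)"
      using derivative by (rule has_vector_derivative_of_real)
  qed (rule eventually_nhds_x_imp_x[OF extends])
  ultimately show ?thesis
    by (rule vector_derivative_unique_at)
qed

lemma real_analytic_at_inverse_function:
  assumes f_analytic: "real_analytic_at f x" and deriv: "(f has_real_derivative f') (at x)" "f' \<noteq> 0"
    and g_cont: "isCont g (f x)" "g (f x) = x" and inverse: "\<forall>\<^sub>F y in nhds (f x). f (g y) = y"
  shows "real_analytic_at g (f x)"
proof -
  obtain F where F_analytic: "F analytic_on {complex_of_real x}" "F (of_real x) = of_real (f x)"
    and extends: "\<forall>\<^sub>F y in nhds x. F (of_real y) = of_real (f y)"
    using f_analytic real_analytic_atE by metis
  obtain e where F_holomorphic: "e > 0" "F holomorphic_on ball (of_real x) e"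
    using F_analytic(1) by (auto simp: analytic_on_def)
  have "deriv F (of_real x) \<noteq> 0"
    using deriv_complex_extension[OF F_analytic(1) extends deriv(1)] deriv(2) by simp
  obtain r where F_invertible: "r > 0" "ball (complex_of_real x) r \<subseteq> ball (of_real x) e"
      "open (F ` ball (of_real x) r)" "inj_on F (ball (of_real x) r)"
    by (rule has_complex_derivative_locally_invertible[OF F_holomorphic(2) _ open_ball \<open>deriv F (of_real x) \<noteq> 0\<close>])
       (use F_holomorphic(1) in simp_all)
  obtain G where G_inverse: "G holomorphic_on (F ` ball (of_real x) r)"
      "\<And>z. z \<in> ball (of_real x) r \<Longrightarrow> G (F z) = z"
    using holomorphic_has_inverse[OF holomorphic_on_subset[OF F_holomorphic(2) F_invertible(2)] open_ball F_invertible(4)] by metis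
  have g_tendsto: "filterlim g (nhds x) (nhds (f x))"
    using g_cont by (metis isCont_def tendsto_at_iff_tendsto_nhds)
  show ?thesis
  proof (rule real_analytic_atI)
    have "G analytic_on (F ` ball (of_real x) r)"
      using G_inverse(1) F_invertible(3) by (simp add: analytic_on_open)
    moreover have "of_real (f x) \<in> F ` ball (of_real x) r"
      using F_analytic(2) F_invertible(1) by (intro image_eqI[of _ _ "of_real x"]) auto
    ultimately show "G analytic_on {complex_of_real (f x)}"
      using analytic_on_subset by blast
    have "\<forall>\<^sub>F y in nhds x. y \<in> ball x r"
      using F_invertible(1) by (intro eventually_nhds_in_open) auto
    with extends have "\<forall>\<^sub>F y in nhds x. G (of_real (f y)) = of_real y"
      by eventually_elim (metis G_inverse(2) dist_of_real mem_ball)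
    from eventually_compose_filterlim[OF this g_tendsto] inverse
    show "\<forall>\<^sub>F y in nhds (f x). G (of_real y) = of_real (g y)"
      by eventually_elim simp
  qed
qed

section \<open>Gaussian integrals\<close>

lemma sinh_mult_le:
  fixes s y :: real
  assumes "0 \<le> s" "s \<le> 1" "0 \<le> y"
  shows "sinh (s * y) \<le> s * sinh y"
proof -
  have "convex_on {0..} (sinh :: real \<Rightarrow> real)"
    by (rule f''_ge0_imp_convex[where f' = cosh and f'' = sinh]) (auto intro!: derivative_eq_intros)
  from convex_onD[OF this, of s 0 y] assms show ?thesis
    by simp
qed

lemma cosh_diff_one_eq: "2 * cosh x - 2 = 4 * (sinh (x / 2))\<^sup>2" for x :: real
  using cosh_square_eq[of "x / 2"] cosh_double[of "x / 2"] by simp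

lemma cosh_quotient_le:
  fixes s x :: real
  assumes "0 < s" "s \<le> 1"
  shows "\<bar>(2 * cosh (s * x) - 2) / s\<^sup>2\<bar> \<le> 2 * cosh x - 2"
proof -
  have "\<bar>sinh (s * x / 2)\<bar> = sinh (s * (\<bar>x\<bar> / 2))"
    using assms by (simp add: abs_mult flip: sinh_real_abs)
  also have "\<dots> \<le> s * sinh (\<bar>x\<bar> / 2)"
    using assms by (intro sinh_mult_le) auto
  also have "\<dots> = \<bar>s * sinh (x / 2)\<bar>"
    using assms by (simp add: abs_mult flip: sinh_real_abs)
  finally have "(sinh (s * x / 2))\<^sup>2 \<le> (s * sinh (x / 2))\<^sup>2"
    by (simp add: abs_le_square_iff)
  then show ?thesis
    unfolding cosh_diff_one_eq using assms by (simp add: divide_le_eq power_mult_distrib mult_ac)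
qed

lemma has_bochner_integral_dominated_limit:
  fixes f :: "nat \<Rightarrow> 'a \<Rightarrow> real"
  assumes integrals: "\<And>k. has_bochner_integral M (f k) (a k)" and integrals_tendsto: "a \<longlonglongrightarrow> b"
    and limit: "\<And>\<omega>. (\<lambda>k. f k \<omega>) \<longlonglongrightarrow> g \<omega>"
    and dominated: "integrable M w" "\<And>k \<omega>. \<bar>f k \<omega>\<bar> \<le> w \<omega>"
  shows "has_bochner_integral M g b"
proof -
  have f_measurable: "f k \<in> borel_measurable M" for k
    by (rule borel_measurable_has_bochner_integral[OF integrals])
  then have g_measurable: "g \<in> borel_measurable M"
    using limit by (rule borel_measurable_LIMSEQ_real[rotated])
  have "integrable M g"
    by (rule integrable_dominated_convergence[where s = f, OF g_measurable f_measurable dominated(1)])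
       (use limit dominated(2) in auto)
  moreover have "(\<lambda>k. integral\<^sup>L M (f k)) \<longlonglongrightarrow> integral\<^sup>L M g"
    by (rule integral_dominated_convergence[where s = f, OF g_measurable f_measurable dominated(1)])
       (use limit dominated(2) in auto)
  then have "integral\<^sup>L M g = b"
    using integrals_tendsto LIMSEQ_unique unfolding has_bochner_integral_integral_eq[OF integrals] by blast
  ultimately show ?thesis
    by (simp add: has_bochner_integral_iff)
qed

text \<open>The second moment is the limit of the symmetric second difference quotients of the moment
  generating function at \<open>0\<close>.\<close>

lemma second_moment_of_gaussian_mgf:
  fixes X :: "'a \<Rightarrow> real"
  assumes mgf: "\<And>t. has_bochner_integral M (\<lambda>\<omega>. exp (t * X \<omega>)) (exp (t\<^sup>2 * \<sigma> / 2))"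
  shows "has_bochner_integral M (\<lambda>\<omega>. (X \<omega>)\<^sup>2) \<sigma>"
proof (rule has_bochner_integral_dominated_limit)
  let ?s = "\<lambda>k. inverse (real (Suc k))"
  have two_cosh: "2 * cosh x = exp x + exp (- x)" for x :: real
    by (simp add: cosh_field_def)
  have cosh: "has_bochner_integral M (\<lambda>\<omega>. 2 * cosh (t * X \<omega>) - 2) (2 * exp (t\<^sup>2 * \<sigma> / 2) - 2)" for t
    using has_bochner_integral_diff[OF has_bochner_integral_add[OF mgf[of t] mgf[of "- t"]]
        has_bochner_integral_mult_right[OF mgf[of 0], where c = 2]]
    by (simp add: two_cosh)
  show "has_bochner_integral M (\<lambda>\<omega>. (2 * cosh (?s k * X \<omega>) - 2) / (?s k)\<^sup>2)
      ((2 * exp ((?s k)\<^sup>2 * \<sigma> / 2) - 2) / (?s k)\<^sup>2)" for k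
    by (intro has_bochner_integral_divide_zero cosh)
  show "(\<lambda>k. (2 * exp ((?s k)\<^sup>2 * \<sigma> / 2) - 2) / (?s k)\<^sup>2) \<longlonglongrightarrow> \<sigma>"
    by real_asymp
  show "(\<lambda>k. (2 * cosh (?s k * X \<omega>) - 2) / (?s k)\<^sup>2) \<longlonglongrightarrow> (X \<omega>)\<^sup>2" for \<omega>
    unfolding power2_eq_square cosh_field_def by real_asymp
  show "integrable M (\<lambda>\<omega>. 2 * cosh (X \<omega>) - 2)"
    using cosh[of 1] by (simp add: has_bochner_integral_iff)
  show "\<bar>(2 * cosh (?s k * X \<omega>) - 2) / (?s k)\<^sup>2\<bar> \<le> 2 * cosh (X \<omega>) - 2" for k \<omega>
    by (rule cosh_quotient_le) (simp_all add: field_simps)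
qed

lemma has_bochner_integral_distr_invariant:
  fixes f :: "'a \<Rightarrow> 'b::{banach, second_countable_topology}"
  assumes invariant: "T \<in> M \<rightarrow>\<^sub>M M" "distr M M T = M" and integral: "has_bochner_integral M f z"
  shows "has_bochner_integral M (\<lambda>x. f (T x)) z"
  using integrable_distr_eq[of T M M f] integral_distr[of T M M f] invariant integral
  by (simp add: has_bochner_integral_iff borel_measurable_integrable)

lemma (in product_sigma_finite) distr_PiM_componentwise:
  assumes finite: "finite I" and measurable: "\<And>i. i \<in> I \<Longrightarrow> T i \<in> M i \<rightarrow>\<^sub>M M i"
    and invariant: "\<And>i. i \<in> I \<Longrightarrow> distr (M i) (M i) (T i) = M i"
  shows "distr (PiM I M) (PiM I M) (\<lambda>x. \<lambda>i\<in>I. T i (x i)) = PiM I M"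
proof (rule PiM_eqI[OF finite])
  have [measurable]: "(\<lambda>x. \<lambda>i\<in>I. T i (x i)) \<in> PiM I M \<rightarrow>\<^sub>M PiM I M"
    using measurable by (intro measurable_restrict measurable_compose[OF measurable_component_singleton])
  fix A assume A_sets: "\<And>i. i \<in> I \<Longrightarrow> A i \<in> sets (M i)"
  define B where "B i = T i -` A i \<inter> space (M i)" for i
  have B_measure: "B i \<in> sets (M i)" "emeasure (M i) (B i) = emeasure (M i) (A i)" if "i \<in> I" for i
    using that A_sets measurable emeasure_distr[of "T i" "M i" "M i" "A i"]
    by (auto simp: B_def invariant intro: measurable_sets)
  have "(\<lambda>x. \<lambda>i\<in>I. T i (x i)) -` Pi\<^sub>E I A \<inter> space (PiM I M) = Pi\<^sub>E I B"
    by (auto simp: B_def space_PiM PiE_iff)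
  then show "emeasure (distr (PiM I M) (PiM I M) (\<lambda>x. \<lambda>i\<in>I. T i (x i))) (Pi\<^sub>E I A)
      = (\<Prod>i\<in>I. emeasure (M i) (A i))"
    using A_sets finite B_measure by (simp add: emeasure_distr sets_PiM_I_finite emeasure_PiM cong: prod.cong)
qed simp

lemma distr_PiM_lborel_translate:
  fixes f :: "'i \<Rightarrow> 'a::euclidean_space"
  assumes "finite I"
  shows "distr (PiM I (\<lambda>_. lborel)) (PiM I (\<lambda>_. lborel)) (\<lambda>x. \<lambda>i\<in>I. x i + f i) = PiM I (\<lambda>_. lborel)"
proof -
  interpret product_sigma_finite "\<lambda>_::'i. lborel :: 'a measure" by standard
  have "distr lborel lborel (\<lambda>x. x + f i) = lborel" for i
    using lborel_distr_plus[of "f i"] by (simp add: add.commute[of _ "f i"] cong: distr_cong)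
  then show ?thesis
    by (intro distr_PiM_componentwise assms) auto
qed

lemma has_bochner_integral_PiM_prod:
  fixes f :: "'i \<Rightarrow> 'a::euclidean_space \<Rightarrow> real"
  assumes "finite I" and factors: "\<And>i. i \<in> I \<Longrightarrow> has_bochner_integral lborel (f i) (z i)"
  shows "has_bochner_integral (PiM I (\<lambda>_. lborel)) (\<lambda>x. \<Prod>i\<in>I. f i (x i)) (\<Prod>i\<in>I. z i)"
proof -
  interpret product_sigma_finite "\<lambda>_::'i. lborel :: 'a measure" by standard
  have "integrable lborel (f i)" "integral\<^sup>L lborel (f i) = z i" if "i \<in> I" for i
    using factors[OF that] by (simp_all add: has_bochner_integral_iff)
  then show ?thesis
    using assms(1) by (simp add: has_bochner_integral_iff product_integrable_prod product_integral_prod)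
qed

lemma has_bochner_integral_gaussian_real:
  fixes t :: real
  assumes "t > 0"
  shows "has_bochner_integral lborel (\<lambda>x. exp (- t * x\<^sup>2 / 2)) (sqrt (2 * pi / t))"
proof -
  have "exp (- t * x\<^sup>2 / 2) = sqrt (2 * pi / t) * normal_density 0 (1 / sqrt t) x" for x
    using assms by (simp add: normal_density_def field_simps real_sqrt_divide real_sqrt_mult)
  then show ?thesis
    using assms by (simp add: has_bochner_integral_iff)
qed

lemma has_bochner_integral_gaussian:
  fixes t :: real
  assumes "t > 0"
  shows "has_bochner_integral lborel (\<lambda>x::'a::euclidean_space. exp (- t * (x \<bullet> x) / 2))
      (sqrt (2 * pi / t) ^ DIM('a))"
proof -
  let ?E = "\<lambda>x. \<Sum>b\<in>Basis. x b *\<^sub>R b :: 'a"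
  have "x \<bullet> x = (\<Sum>b\<in>Basis. (x \<bullet> b)\<^sup>2)" for x :: 'a
    by (subst euclidean_inner) (simp add: power2_eq_square)
  then have "exp (- t * (?E x \<bullet> ?E x) / 2) = (\<Prod>b\<in>Basis. exp (- t * (x b)\<^sup>2 / 2))" for x
    by (simp add: sum_distrib_left sum_divide_distrib sum_negf flip: exp_sum)
  then have "has_bochner_integral (PiM Basis (\<lambda>_. lborel)) (\<lambda>x. exp (- t * (?E x \<bullet> ?E x) / 2))
      (sqrt (2 * pi / t) ^ DIM('a))"
    using has_bochner_integral_PiM_prod[of Basis "\<lambda>_ x. exp (- t * x\<^sup>2 / 2)" "\<lambda>_. sqrt (2 * pi / t)"]
      has_bochner_integral_gaussian_real[OF assms] by simp
  then show ?thesis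
    by (subst lborel_eq) (auto intro!: has_bochner_integral_distr)
qed

lemma has_bochner_integral_gaussian_PiM:
  fixes t :: real and I :: "'i set"
  assumes "finite I" "t > 0"
  shows "has_bochner_integral (PiM I (\<lambda>_. lborel))
    (\<lambda>x :: 'i \<Rightarrow> 'a::euclidean_space. exp (- t * (\<Sum>i\<in>I. x i \<bullet> x i) / 2))
    ((sqrt (2 * pi / t) ^ DIM('a)) ^ card I)"
proof -
  have "exp (- t * (\<Sum>i\<in>I. x i \<bullet> x i) / 2) = (\<Prod>i\<in>I. exp (- t * (x i \<bullet> x i) / 2))" for x :: "'i \<Rightarrow> 'a"
    using assms(1) by (simp add: sum_distrib_left sum_divide_distrib sum_negf flip: exp_sum)
  then show ?thesis
    using has_bochner_integral_PiM_prod[OF assms(1)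
        has_bochner_integral_gaussian[OF assms(2)], where 'a = 'a]
    by simp
qed

section \<open>The hopping operator on the lattice\<close>

type_synonym lattice_site = "int \<times> int \<times> int"
type_synonym lattice_field = "lattice_site \<Rightarrow> real \<times> real"

text \<open>Since \<open>a mod 0 = a\<close>, taking \<open>L = 0\<close> in \<open>reduce\<close> and in everything built on it gives the
  objects of the infinite lattice.\<close>

definition reduce :: "nat \<Rightarrow> lattice_site \<Rightarrow> lattice_site" where
  "reduce L r = (case r of (a, b, c) \<Rightarrow> (a mod int L, b mod int L, c mod int L))"

definition cell :: "nat \<Rightarrow> lattice_site set" where
  "cell L = {0..<int L} \<times> {0..<int L} \<times> {0..<int L}"

definition periodic :: "nat \<Rightarrow> (lattice_site \<Rightarrow> 'a) \<Rightarrow> bool" where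
  "periodic L f \<longleftrightarrow> (\<forall>r. f (reduce L r) = f r)"

definition bonds :: "(lattice_site \<times> (real \<times> real)) set" where
  "bonds = {((1, 0, 0), vec_a), ((0, 1, 0), vec_b), ((0, 0, 1), vec_c)}"

definition torus_inner :: "nat \<Rightarrow> lattice_field \<Rightarrow> lattice_field \<Rightarrow> real" where
  "torus_inner L f g = (\<Sum>r\<in>cell L. f r \<bullet> g r)"

definition bond_energy ::
    "nat \<Rightarrow> lattice_site \<Rightarrow> real \<times> real \<Rightarrow> lattice_field \<Rightarrow> lattice_field \<Rightarrow> real" where
  "bond_energy L e v f g = (\<Sum>r\<in>cell L. ((f r - f (r + e)) \<bullet> v) * ((g r - g (r + e)) \<bullet> v))"

definition energy :: "nat \<Rightarrow> lattice_field \<Rightarrow> lattice_field \<Rightarrow> real" where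
  "energy L f g = (\<Sum>(e, v)\<in>bonds. bond_energy L e v f g)"

definition bond_hop :: "lattice_site \<Rightarrow> real \<times> real \<Rightarrow> lattice_field \<Rightarrow> lattice_field" where
  "bond_hop e v f r = ((2 *\<^sub>R f r + f (r + e) + f (r - e)) \<bullet> v) *\<^sub>R v"

text \<open>The interaction operator \<open>A\<close>, defined by \<open>energy L f g = torus_inner L f (A g)\<close>, equals
  \<open>6 - hop\<close> because the three spin directions form a tight frame; \<open>hop\<close> is \<open>A\<close> with every
  difference replaced by a sum.\<close>

definition hop :: "lattice_field \<Rightarrow> lattice_field" where
  "hop f r = (\<Sum>(e, v)\<in>bonds. bond_hop e v f r)"

lemma finite_cell [simp]: "finite (cell L)"
  by (simp add: cell_def)

lemma card_cell: "card (cell L) = L ^ 3"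
  by (simp add: cell_def card_cartesian_product power3_eq_cube)

lemma reduce_in_cell: "L > 0 \<Longrightarrow> reduce L r \<in> cell L"
  by (auto simp: reduce_def cell_def split: prod.splits)

lemma reduce_id: "r \<in> cell L \<Longrightarrow> reduce L r = r"
  by (auto simp: reduce_def cell_def)

lemma reduce_length_0 [simp]: "reduce 0 r = r"
  by (auto simp: reduce_def)

lemma reduce_origin [simp]: "reduce L 0 = 0"
  by (simp add: reduce_def zero_prod_def)

lemma reduce_reduce_add: "reduce L (reduce L r + e) = reduce L (r + e)"
  by (cases r; cases e) (simp add: reduce_def mod_simps)

lemma reduce_reduce_diff: "reduce L (reduce L r - e) = reduce L (r - e)"
  by (cases r; cases e) (simp add: reduce_def mod_simps)

lemma periodicD: "periodic L f \<Longrightarrow> f (reduce L r) = f r"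
  unfolding periodic_def by blast

lemma periodic_add: "periodic L f \<Longrightarrow> periodic L (\<lambda>r. f (r + e))"
  unfolding periodic_def by (metis reduce_reduce_add)

lemma periodic_diff: "periodic L f \<Longrightarrow> periodic L (\<lambda>r. f (r - e))"
  unfolding periodic_def by (metis reduce_reduce_diff)

lemma sum_bonds: "(\<Sum>b\<in>bonds. F b) = F ((1, 0, 0), vec_a) + F ((0, 1, 0), vec_b) + F ((0, 0, 1), vec_c)"
  for F :: "_ \<Rightarrow> 'a::comm_monoid_add"
  by (simp add: bonds_def add.assoc)

lemma tight_frame: "(\<Sum>(e, v)\<in>bonds. (x \<bullet> v) * (y \<bullet> v)) = 3 / 2 * (x \<bullet> y)"
proof (cases x; cases y)
  fix a b c d assume "x = (a, b)" "y = (c, d)"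
  moreover have "sqrt 3 * (sqrt 3 * z) = 3 * z" for z :: real
    by (simp flip: mult.assoc)
  ultimately show ?thesis
    by (simp add: sum_bonds vec_a_def vec_b_def vec_c_def field_simps)
qed

lemma torus_inner_commute: "torus_inner L f g = torus_inner L g f"
  by (simp add: torus_inner_def inner_commute)

lemma torus_inner_nonneg: "torus_inner L f f \<ge> 0"
  by (simp add: torus_inner_def sum_nonneg)

lemma energy_commute: "energy L f g = energy L g f"
  by (simp add: energy_def bond_energy_def mult.commute)

lemma bond_energy_nonneg: "bond_energy L e v f f \<ge> 0"
  by (simp add: bond_energy_def sum_nonneg)

lemma energy_nonneg: "energy L f f \<ge> 0"
  unfolding energy_def by (intro sum_nonneg) (auto intro: bond_energy_nonneg)

lemma torus_inner_add_scaleR_left: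
  "torus_inner L (\<lambda>r. f r + s *\<^sub>R g r) h = torus_inner L f h + s * torus_inner L g h"
  by (simp add: torus_inner_def inner_simps sum.distrib sum_distrib_left)

lemma torus_inner_add_scaleR_right:
  "torus_inner L h (\<lambda>r. f r + s *\<^sub>R g r) = torus_inner L h f + s * torus_inner L h g"
  by (simp add: torus_inner_def inner_simps sum.distrib sum_distrib_left)

lemma bond_energy_add_scaleR_left:
  "bond_energy L e v (\<lambda>r. f r + s *\<^sub>R g r) h = bond_energy L e v f h + s * bond_energy L e v g h"
  unfolding bond_energy_def sum_distrib_left sum.distrib[symmetric]
  by (intro sum.cong) (auto simp: inner_simps algebra_simps)

lemma energy_add_scaleR_left:
  "energy L (\<lambda>r. f r + s *\<^sub>R g r) h = energy L f h + s * energy L g h"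
  unfolding energy_def sum_distrib_left sum.distrib[symmetric]
  by (intro sum.cong) (auto simp: bond_energy_add_scaleR_left)

lemma hop_add_scaleR: "hop (\<lambda>r. f r + s *\<^sub>R g r) = (\<lambda>r. hop f r + s *\<^sub>R hop g r)"
proof
  show "hop (\<lambda>r. f r + s *\<^sub>R g r) r = hop f r + s *\<^sub>R hop g r" for r
    unfolding hop_def scaleR_sum_right sum.distrib[symmetric]
    by (intro sum.cong) (auto simp: bond_hop_def inner_simps algebra_simps)
qed

lemma hop_zero: "hop (\<lambda>_. 0) = (\<lambda>_. 0)"
  by (rule ext) (simp add: hop_def bond_hop_def case_prod_beta)

lemma hop_scaleR: "hop (\<lambda>r. c *\<^sub>R f r) = (\<lambda>r. c *\<^sub>R hop f r)"
  using hop_add_scaleR[of "\<lambda>_. 0" c f] by (simp add: hop_zero)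

lemma hop_translate: "hop (\<lambda>r. f (r - r\<^sub>0)) = (\<lambda>r. hop f (r - r\<^sub>0))"
  by (rule ext) (simp add: hop_def bond_hop_def algebra_simps)

lemma periodic_hop:
  assumes "periodic L f"
  shows "periodic L (hop f)"
proof -
  have "f (reduce L r + e) = f (r + e)" "f (reduce L r - e) = f (r - e)" for r e
    using periodicD[OF periodic_add[OF assms]] periodicD[OF periodic_diff[OF assms]] by auto
  then show ?thesis
    unfolding periodic_def hop_def bond_hop_def periodicD[OF assms] by simp
qed

lemma periodic_hop_funpow: "periodic L f \<Longrightarrow> periodic L ((hop ^^ n) f)"
  by (induction n) (auto intro: periodic_hop)

context
  fixes L :: nat
  assumes L_pos: "L > 0"
begin

lemma sum_cell_shift:
  assumes "periodic L f"
  shows "(\<Sum>r\<in>cell L. f (r + e)) = (\<Sum>r\<in>cell L. f r)"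
proof (rule sum.reindex_bij_witness[where i = "\<lambda>r. reduce L (r - e)" and j = "\<lambda>r. reduce L (r + e)"])
  fix r assume r_in_cell: "r \<in> cell L"
  show "reduce L (reduce L (r + e) - e) = r" "reduce L (reduce L (r - e) + e) = r"
    using r_in_cell by (simp_all add: reduce_reduce_diff reduce_reduce_add reduce_id)
  show "f (reduce L (r + e)) = f (r + e)"
    using assms by (rule periodicD)
qed (auto intro: reduce_in_cell L_pos)

lemma torus_inner_bond_hop:
  assumes "periodic L f" "periodic L g"
  shows "torus_inner L f (bond_hop e v g)
      = (\<Sum>r\<in>cell L. ((f r + f (r + e)) \<bullet> v) * ((g r + g (r + e)) \<bullet> v))"
proof -
  let ?a = "\<lambda>r. f r \<bullet> v" and ?b = "\<lambda>r. g r \<bullet> v"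
  have "periodic L (\<lambda>r. ?a r * ?b (r - e))" "periodic L (\<lambda>r. ?a r * ?b r)"
    using assms periodic_diff[OF assms(2), of e] by (simp_all add: periodic_def)
  then have shifted: "(\<Sum>r\<in>cell L. ?a (r + e) * ?b r) = (\<Sum>r\<in>cell L. ?a r * ?b (r - e))"
      "(\<Sum>r\<in>cell L. ?a (r + e) * ?b (r + e)) = (\<Sum>r\<in>cell L. ?a r * ?b r)"
    using sum_cell_shift[of "\<lambda>r. ?a r * ?b (r - e)" e] sum_cell_shift[of "\<lambda>r. ?a r * ?b r" e]
    by simp_all
  have "torus_inner L f (bond_hop e v g)
      = (\<Sum>r\<in>cell L. 2 * (?a r * ?b r) + ?a r * ?b (r + e) + ?a r * ?b (r - e))"
    unfolding torus_inner_def bond_hop_def by (intro sum.cong) (auto simp: inner_simps algebra_simps)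
  also have "\<dots> = (\<Sum>r\<in>cell L. ?a r * ?b r + ?a (r + e) * ?b (r + e)
      + ?a r * ?b (r + e) + ?a (r + e) * ?b r)"
    by (simp add: sum.distrib shifted flip: sum_distrib_left)
  also have "\<dots> = (\<Sum>r\<in>cell L. ((f r + f (r + e)) \<bullet> v) * ((g r + g (r + e)) \<bullet> v))"
    by (intro sum.cong) (auto simp: inner_simps algebra_simps)
  finally show ?thesis .
qed

lemma bond_energy_plus_bond_hop:
  assumes "periodic L f" "periodic L g"
  shows "bond_energy L e v f g + torus_inner L f (bond_hop e v g)
      = 4 * (\<Sum>r\<in>cell L. (f r \<bullet> v) * (g r \<bullet> v))"
proof -
  have "periodic L (\<lambda>r. (f r \<bullet> v) * (g r \<bullet> v))"
    using assms by (simp add: periodic_def)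
  then have shifted: "(\<Sum>r\<in>cell L. (f (r + e) \<bullet> v) * (g (r + e) \<bullet> v))
      = (\<Sum>r\<in>cell L. (f r \<bullet> v) * (g r \<bullet> v))"
    by (rule sum_cell_shift)
  have "bond_energy L e v f g + torus_inner L f (bond_hop e v g)
     = (\<Sum>r\<in>cell L. 2 * ((f r \<bullet> v) * (g r \<bullet> v)) + 2 * ((f (r + e) \<bullet> v) * (g (r + e) \<bullet> v)))"
    unfolding torus_inner_bond_hop[OF assms] bond_energy_def sum.distrib[symmetric]
    by (intro sum.cong) (auto simp: inner_simps algebra_simps)
  then show ?thesis
    by (simp add: sum.distrib shifted flip: sum_distrib_left)
qed

lemma torus_inner_hop: "torus_inner L f (hop g) = (\<Sum>(e, v)\<in>bonds. torus_inner L f (bond_hop e v g))"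
  unfolding torus_inner_def hop_def inner_sum_right by (subst sum.swap) (simp add: case_prod_beta)

lemma energy_plus_hop:
  assumes "periodic L f" "periodic L g"
  shows "energy L f g + torus_inner L f (hop g) = 6 * torus_inner L f g"
proof -
  have "energy L f g + torus_inner L f (hop g)
      = (\<Sum>(e, v)\<in>bonds. 4 * (\<Sum>r\<in>cell L. (f r \<bullet> v) * (g r \<bullet> v)))"
    unfolding energy_def torus_inner_hop sum.distrib[symmetric]
    by (intro sum.cong) (auto simp: bond_energy_plus_bond_hop[OF assms])
  also have "\<dots> = 4 * (\<Sum>r\<in>cell L. \<Sum>(e, v)\<in>bonds. (f r \<bullet> v) * (g r \<bullet> v))"
    unfolding case_prod_beta sum_distrib_left[symmetric] by (subst sum.swap) simp
  also have "\<dots> = 6 * torus_inner L f g"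
    by (simp add: tight_frame torus_inner_def flip: sum_distrib_left sum_divide_distrib)
  finally show ?thesis .
qed

lemma torus_inner_hop_commute:
  assumes "periodic L f" "periodic L g"
  shows "torus_inner L f (hop g) = torus_inner L (hop f) g"
  using energy_plus_hop[OF assms] energy_plus_hop[OF assms(2,1)] energy_commute[of L f g]
    torus_inner_commute[of L f g] torus_inner_commute[of L "hop f" g]
  by simp

lemma torus_inner_hop_nonneg:
  assumes "periodic L f"
  shows "torus_inner L f (hop f) \<ge> 0"
  unfolding torus_inner_hop by (auto intro!: sum_nonneg simp: torus_inner_bond_hop assms)

lemma torus_inner_hop_le:
  assumes "periodic L f"
  shows "torus_inner L f (hop f) \<le> 6 * torus_inner L f f"
  using energy_plus_hop[OF assms assms] energy_nonneg[of L f] by linarith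

lemma energy_le:
  assumes "periodic L f"
  shows "energy L f f \<le> 6 * torus_inner L f f"
  using energy_plus_hop[OF assms assms] torus_inner_hop_nonneg[OF assms] by linarith

text \<open>Positivity of the form of \<open>hop\<close> at \<open>f - hop f / 6\<close>, combined with \<open>hop \<le> 6\<close>.\<close>

lemma torus_inner_hop_hop_le:
  assumes "periodic L f"
  shows "torus_inner L (hop f) (hop f) \<le> 36 * torus_inner L f f"
proof -
  let ?g = "hop f" and ?h = "\<lambda>r. f r + (-1/6) *\<^sub>R hop f r"
  have hop_periodic: "periodic L ?g" using assms by (rule periodic_hop)
  have "0 \<le> torus_inner L ?h (hop ?h)"
    using assms hop_periodic by (intro torus_inner_hop_nonneg) (simp add: periodic_def)
  also have "\<dots> = torus_inner L f ?g - 1/6 * torus_inner L f (hop ?g) - 1/6 * torus_inner L ?g ?g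
      + 1/36 * torus_inner L ?g (hop ?g)"
    unfolding hop_add_scaleR torus_inner_add_scaleR_left torus_inner_add_scaleR_right
    by (simp add: field_simps)
  also have "torus_inner L f (hop ?g) = torus_inner L ?g ?g"
    by (rule torus_inner_hop_commute[OF assms hop_periodic])
  finally show ?thesis
    using torus_inner_hop_le[OF hop_periodic] torus_inner_hop_le[OF assms] by linarith
qed

lemma torus_inner_hop_funpow_le:
  assumes "periodic L f"
  shows "torus_inner L ((hop ^^ n) f) ((hop ^^ n) f) \<le> 36 ^ n * torus_inner L f f"
proof (induction n)
  case (Suc n)
  have "torus_inner L ((hop ^^ Suc n) f) ((hop ^^ Suc n) f)
      \<le> 36 * torus_inner L ((hop ^^ n) f) ((hop ^^ n) f)"
    using torus_inner_hop_hop_le[OF periodic_hop_funpow[OF assms]] by simp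
  with Suc show ?case by simp
qed simp

lemma torus_inner_hop_funpow_add:
  assumes "periodic L f"
  shows "torus_inner L f ((hop ^^ (m + n)) f) = torus_inner L ((hop ^^ m) f) ((hop ^^ n) f)"
proof (induction m arbitrary: n)
  case (Suc m)
  have "torus_inner L f ((hop ^^ (Suc m + n)) f) = torus_inner L ((hop ^^ m) f) (hop ((hop ^^ n) f))"
    using Suc[of "Suc n"] by simp
  also have "\<dots> = torus_inner L (hop ((hop ^^ m) f)) ((hop ^^ n) f)"
    by (intro torus_inner_hop_commute periodic_hop_funpow assms)
  finally show ?case by simp
qed simp

lemma torus_inner_hop_funpow_nonneg:
  assumes "periodic L f"
  shows "torus_inner L f ((hop ^^ n) f) \<ge> 0"
proof (cases "even n")
  case True
  then obtain k where "n = k + k" by (metis evenE mult_2)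
  then show ?thesis
    by (simp only: torus_inner_hop_funpow_add[OF assms] torus_inner_nonneg)
next
  case False
  then obtain k where "n = k + Suc k" by (metis oddE add_Suc_right mult_2 Suc_eq_plus1)
  then show ?thesis
    by (simp only: torus_inner_hop_funpow_add[OF assms])
       (simp add: torus_inner_hop_nonneg periodic_hop_funpow assms)
qed

lemma norm_le_torus_inner:
  assumes "periodic L f"
  shows "(norm (f r))\<^sup>2 \<le> torus_inner L f f"
proof -
  have "f (reduce L r) \<bullet> f (reduce L r) \<le> torus_inner L f f"
    unfolding torus_inner_def by (rule member_le_sum) (auto intro: reduce_in_cell L_pos)
  then show ?thesis
    using assms by (simp only: periodicD power2_norm_eq_inner)
qed

end

section \<open>Powers of the hopping operator\<close>

definition delta :: "nat \<Rightarrow> real \<times> real \<Rightarrow> lattice_field" where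
  "delta L w r = (if reduce L r = 0 then w else 0)"

definition hop_kernel :: "nat \<Rightarrow> nat \<Rightarrow> real \<times> real \<Rightarrow> lattice_field" where
  "hop_kernel n L w = (hop ^^ n) (delta L w)"

definition lattice_norm :: "lattice_site \<Rightarrow> int" where
  "lattice_norm r = (case r of (a, b, c) \<Rightarrow> max \<bar>a\<bar> (max \<bar>b\<bar> \<bar>c\<bar>))"

lemma hop_kernel_0: "hop_kernel 0 L w = delta L w"
  by (simp add: hop_kernel_def)

lemma hop_kernel_Suc: "hop_kernel (Suc n) L w = hop (hop_kernel n L w)"
  by (simp add: hop_kernel_def)

lemma delta_origin [simp]: "delta L w 0 = w"
  by (simp add: delta_def)

lemma periodic_delta [simp]: "periodic L (delta L w)"
  using reduce_reduce_add[of L _ 0] by (simp add: periodic_def delta_def)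

lemma periodic_hop_kernel [simp]: "periodic L (hop_kernel n L w)"
  by (simp add: hop_kernel_def periodic_hop_funpow)

lemma torus_inner_delta:
  assumes "L > 0" "periodic L g"
  shows "torus_inner L (\<lambda>r. delta L w (r - r\<^sub>0)) g = w \<bullet> g r\<^sub>0"
proof -
  have "periodic L (\<lambda>r. delta L w (r - r\<^sub>0) \<bullet> g r)"
    using assms(2) periodic_diff[OF periodic_delta[of L w], of r\<^sub>0] by (simp add: periodic_def)
  from sum_cell_shift[OF assms(1) this, of r\<^sub>0]
  have "torus_inner L (\<lambda>r. delta L w (r - r\<^sub>0)) g = (\<Sum>r\<in>cell L. delta L w r \<bullet> g (r + r\<^sub>0))"
    by (simp add: torus_inner_def)
  also have "\<dots> = (\<Sum>r\<in>cell L. if r = 0 then w \<bullet> g r\<^sub>0 else 0)"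
    by (intro sum.cong) (auto simp: delta_def reduce_id)
  also have "\<dots> = w \<bullet> g r\<^sub>0"
    using assms(1) by (simp add: sum.delta) (simp add: cell_def zero_prod_def)
  finally show ?thesis .
qed

lemma lattice_norm_nonneg: "lattice_norm r \<ge> 0"
  by (auto simp: lattice_norm_def split: prod.splits)

lemma lattice_norm_zero [simp]: "lattice_norm 0 = 0"
  by (simp add: lattice_norm_def zero_prod_def)

lemma lattice_norm_minus [simp]: "lattice_norm (- r) = lattice_norm r"
  by (cases r) (simp add: lattice_norm_def)

lemma lattice_norm_triangle: "lattice_norm (r + s) \<le> lattice_norm r + lattice_norm s"
proof (cases r; cases s)
  fix a b c a' b' c' assume "r = (a, b, c)" "s = (a', b', c')"
  then show ?thesis
    unfolding lattice_norm_def
    by (simp, intro conjI order_trans[OF abs_triangle_ineq] add_mono) (simp_all add: le_max_iff_disj)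
qed

lemma lattice_norm_triangle_diff: "lattice_norm (r - t) \<le> lattice_norm (r - s) + lattice_norm (s - t)"
  using lattice_norm_triangle[of "r - s" "s - t"] by simp

lemma lattice_norm_bond: "(e, v) \<in> bonds \<Longrightarrow> lattice_norm e = 1"
  by (auto simp: bonds_def lattice_norm_def)

lemma hop_cong_near:
  assumes "\<And>s. lattice_norm (s - r) \<le> 1 \<Longrightarrow> f s = g s"
  shows "hop f r = hop g r"
proof -
  have "bond_hop e v f r = bond_hop e v g r" if "(e, v) \<in> bonds" for e v
    using assms[of r] assms[of "r + e"] assms[of "r - e"] lattice_norm_bond[OF that]
    by (simp add: bond_hop_def)
  then show ?thesis
    unfolding hop_def by (intro sum.cong) auto
qed

lemma hop_funpow_cong_near:
  assumes "\<And>s. lattice_norm (s - r) \<le> int n \<Longrightarrow> f s = g s"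
  shows "(hop ^^ n) f r = (hop ^^ n) g r"
  using assms
proof (induction n arbitrary: r)
  case 0
  then show ?case by simp
next
  case (Suc n)
  have "(hop ^^ n) f s = (hop ^^ n) g s" if "lattice_norm (s - r) \<le> 1" for s
  proof (rule Suc.IH)
    fix t assume "lattice_norm (t - s) \<le> int n"
    then show "f t = g t"
      using Suc.prems[of t] lattice_norm_triangle_diff[of t r s] that by simp
  qed
  then show ?case
    unfolding funpow.simps o_apply by (rule hop_cong_near)
qed

lemma delta_eq_infinite_lattice:
  assumes "lattice_norm r < int L"
  shows "delta L w r = delta 0 w r"
proof -
  have "a mod int L = 0 \<longleftrightarrow> a = 0" if "\<bar>a\<bar> < int L" for a
    using that by (metis dvd_imp_le_int mod_0 mod_0_imp_dvd nat_int not_less abs_of_nat)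
  then show ?thesis
    using assms by (cases r) (auto simp: lattice_norm_def delta_def reduce_def zero_prod_def)
qed

lemma hop_kernel_eq_infinite_lattice:
  assumes "lattice_norm r + int n < int L"
  shows "hop_kernel n L w r = hop_kernel n 0 w r"
  unfolding hop_kernel_def
proof (intro hop_funpow_cong_near delta_eq_infinite_lattice)
  fix s assume "lattice_norm (s - r) \<le> int n"
  then show "lattice_norm s < int L"
    using assms lattice_norm_triangle[of "s - r" r] by simp
qed

lemma hop_kernel_eventually_infinite_lattice:
  "\<forall>\<^sub>F L in sequentially. hop_kernel n L w r = hop_kernel n 0 w r"
  using eventually_gt_at_top[of "nat (lattice_norm r + int n)"]
  by eventually_elim (auto intro: hop_kernel_eq_infinite_lattice)

lemma hop_kernel_eq_0:
  assumes "int n < lattice_norm r"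
  shows "hop_kernel n 0 w r = 0"
proof -
  have "(hop ^^ n) (delta 0 w) r = (hop ^^ n) (\<lambda>_. 0) r"
  proof (rule hop_funpow_cong_near)
    fix s assume "lattice_norm (s - r) \<le> int n"
    then have "s \<noteq> 0" using assms by auto
    then show "delta 0 w s = 0" by (simp add: delta_def)
  qed
  moreover have "(hop ^^ n) (\<lambda>_. 0) = (\<lambda>_. 0)"
    by (induction n) (simp_all add: hop_zero)
  ultimately show ?thesis
    by (simp add: hop_kernel_def)
qed

lemma norm_hop_kernel_le: "norm (hop_kernel n L w r) \<le> 6 ^ n * norm w"
proof -
  have "(36::real) ^ n = (6 ^ n)\<^sup>2"
    by (simp add: power2_eq_square flip: power_mult_distrib)
  then have square: "36 ^ n * (norm w)\<^sup>2 = (6 ^ n * norm w)\<^sup>2"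
    by (simp add: power_mult_distrib)
  have torus: "norm (hop_kernel n L w r) \<le> 6 ^ n * norm w" if "L > 0" for L
  proof (rule power2_le_imp_le)
    have "(norm (hop_kernel n L w r))\<^sup>2 \<le> torus_inner L (hop_kernel n L w) (hop_kernel n L w)"
      by (rule norm_le_torus_inner[OF that]) simp
    also have "\<dots> \<le> 36 ^ n * torus_inner L (delta L w) (delta L w)"
      unfolding hop_kernel_def by (rule torus_inner_hop_funpow_le[OF that]) simp
    also have "torus_inner L (delta L w) (delta L w) = (norm w)\<^sup>2"
      using torus_inner_delta[OF that periodic_delta, of w 0 w] by (simp add: power2_norm_eq_inner)
    finally show "(norm (hop_kernel n L w r))\<^sup>2 \<le> (6 ^ n * norm w)\<^sup>2"
      unfolding square .
  qed simp
  show ?thesis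
  proof (cases "L = 0")
    case True
    let ?L = "nat (lattice_norm r + int n + 1)"
    have "hop_kernel n 0 w r = hop_kernel n ?L w r"
      by (rule hop_kernel_eq_infinite_lattice[symmetric]) simp
    then show ?thesis
      using torus[of ?L] lattice_norm_nonneg[of r] True by simp
  qed (use torus in simp)
qed

lemma hop_kernel_diag_nonneg: "hop_kernel n L w 0 \<bullet> w \<ge> 0"
proof -
  have torus: "hop_kernel n L w 0 \<bullet> w \<ge> 0" if "L > 0" for L
    using torus_inner_hop_funpow_nonneg[OF that periodic_delta, of w n]
      torus_inner_delta[OF that periodic_hop_kernel, of w 0 n w]
    by (simp add: hop_kernel_def inner_commute)
  have "hop_kernel n 0 w 0 = hop_kernel n (Suc n) w 0"
    by (rule hop_kernel_eq_infinite_lattice[symmetric]) simp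
  then show ?thesis
    using torus[of L] torus[of "Suc n"] by (cases "L = 0") auto
qed

section \<open>The lattice Green function\<close>

definition green :: "real \<Rightarrow> nat \<Rightarrow> real \<times> real \<Rightarrow> lattice_field" where
  "green v L w r = (\<Sum>n. v ^ n *\<^sub>R hop_kernel n L w r)"

definition kernel_fps :: "nat \<Rightarrow> real \<times> real \<Rightarrow> real \<times> real \<Rightarrow> lattice_site \<Rightarrow> real fps" where
  "kernel_fps L w w' r = Abs_fps (\<lambda>n. hop_kernel n L w r \<bullet> w')"

definition trace_fps :: "nat \<Rightarrow> real fps" where
  "trace_fps L = (\<Sum>w\<in>Basis. kernel_fps L w w 0)"

lemma abs_kernel_fps_nth_le: "\<bar>fps_nth (kernel_fps L w w' r) n\<bar> \<le> norm w * norm w' * 6 ^ n"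
  using Cauchy_Schwarz_ineq2[of "hop_kernel n L w r" w']
      mult_right_mono[OF norm_hop_kernel_le[of n L w r], of "norm w'"]
  by (simp add: kernel_fps_def mult_ac)

lemma kernel_fps_nth_eventually:
  "\<forall>\<^sub>F L in sequentially. fps_nth (kernel_fps L w w' r) n = fps_nth (kernel_fps 0 w w' r) n"
  using hop_kernel_eventually_infinite_lattice[of n w r] by eventually_elim (simp add: kernel_fps_def)

lemma trace_fps_nth: "fps_nth (trace_fps L) n = (\<Sum>w\<in>Basis. fps_nth (kernel_fps L w w 0) n)"
  by (simp add: trace_fps_def fps_sum_nth)

lemma trace_fps_nth_0: "fps_nth (trace_fps L) 0 = 2"
  by (simp add: trace_fps_nth kernel_fps_def hop_kernel_0)

lemma trace_fps_nth_nonneg: "fps_nth (trace_fps L) n \<ge> 0"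
  by (simp add: trace_fps_nth kernel_fps_def sum_nonneg hop_kernel_diag_nonneg)

lemma abs_trace_fps_nth_le: "\<bar>fps_nth (trace_fps L) n\<bar> \<le> 2 * 6 ^ n"
proof -
  have "\<bar>fps_nth (trace_fps L) n\<bar> \<le> (\<Sum>w\<in>Basis. \<bar>fps_nth (kernel_fps L w w 0) n\<bar>)"
    unfolding trace_fps_nth by (rule sum_abs)
  also have "\<dots> \<le> (\<Sum>w\<in>(Basis :: (real \<times> real) set). 6 ^ n)"
  proof (rule sum_mono)
    fix w :: "real \<times> real" assume "w \<in> Basis"
    then show "\<bar>fps_nth (kernel_fps L w w 0) n\<bar> \<le> 6 ^ n"
      using abs_kernel_fps_nth_le[of L w w 0 n] by simp
  qed
  finally show ?thesis by simp
qed

lemma trace_fps_nth_eventually: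
  "\<forall>\<^sub>F L in sequentially. fps_nth (trace_fps L) n = fps_nth (trace_fps 0) n"
proof -
  have "\<forall>\<^sub>F L in sequentially. \<forall>w\<in>Basis. fps_nth (kernel_fps L w w 0) n
      = fps_nth (kernel_fps 0 w w 0) n"
    by (intro eventually_ball_finite) (auto intro: kernel_fps_nth_eventually)
  then show ?thesis
    by eventually_elim (simp add: trace_fps_nth)
qed

lemma less_fps_conv_radius_if_bounded:
  fixes F :: "real fps" and v :: real
  assumes "\<And>n. \<bar>fps_nth F n\<bar> \<le> C * 6 ^ n" "\<bar>v\<bar> < 1 / 6"
  shows "norm v < fps_conv_radius F"
proof -
  have "ereal (norm v) < ereal (1 / 6)"
    using assms(2) by simp
  also have "\<dots> \<le> fps_conv_radius F"
    by (rule fps_conv_radius_ge_geometric) (use assms(1) in auto)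
  finally show ?thesis .
qed

lemmas less_fps_conv_radius_kernel = less_fps_conv_radius_if_bounded[OF abs_kernel_fps_nth_le]
lemmas less_fps_conv_radius_trace = less_fps_conv_radius_if_bounded[OF abs_trace_fps_nth_le]

lemma hop_sums:
  assumes "\<And>r. (\<lambda>n. s n r) sums f r"
  shows "(\<lambda>n. hop (s n) r) sums hop f r"
  unfolding hop_def bond_hop_def case_prod_beta
  by (intro sums_sum sums_scaleR_left bounded_linear.sums[OF bounded_linear_inner_left] sums_add
      sums_scaleR_right assms)

context
  fixes v :: real
  assumes v_less: "\<bar>v\<bar> < 1 / 6"
begin

lemma sums_green: "(\<lambda>n. v ^ n *\<^sub>R hop_kernel n L w r) sums green v L w r"
  unfolding green_def
proof (rule summable_sums, rule summable_comparison_test')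
  show "summable (\<lambda>n. (6 * \<bar>v\<bar>) ^ n * norm w)"
    using v_less by (intro summable_mult2 summable_geometric) simp
  show "norm (v ^ n *\<^sub>R hop_kernel n L w r) \<le> (6 * \<bar>v\<bar>) ^ n * norm w" for n
    using mult_left_mono[OF norm_hop_kernel_le[of n L w r], of "\<bar>v\<bar> ^ n"]
    by (simp add: power_abs power_mult_distrib mult_ac)
qed

lemma periodic_green: "periodic L (green v L w)"
  unfolding periodic_def green_def periodicD[OF periodic_hop_kernel] by simp

lemma inner_green: "green v L w r \<bullet> w' = eval_fps (kernel_fps L w w' r) v"
  using bounded_linear.sums[OF bounded_linear_inner_left[of w'] sums_green[of L w r]]
  by (simp add: eval_fps_def kernel_fps_def sums_iff mult.commute)

lemma trace_green: "(\<Sum>w\<in>Basis. green v L w 0 \<bullet> w) = eval_fps (trace_fps L) v"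
proof -
  have "(\<lambda>n. \<Sum>w\<in>Basis. fps_nth (kernel_fps L w w 0) n * v ^ n)
      sums (\<Sum>w\<in>Basis. eval_fps (kernel_fps L w w 0) v)"
    by (intro sums_sum sums_eval_fps less_fps_conv_radius_kernel v_less)
  then show ?thesis
    by (simp add: inner_green eval_fps_def[of "trace_fps L"] trace_fps_nth sums_iff sum_distrib_right)
qed

lemma green_equation: "green v L w r - v *\<^sub>R hop (green v L w) r = delta L w r"
proof -
  have "(\<lambda>n. v *\<^sub>R hop (\<lambda>r. v ^ n *\<^sub>R hop_kernel n L w r) r) sums (v *\<^sub>R hop (green v L w) r)"
    by (intro sums_scaleR_right hop_sums sums_green)
  then have "(\<lambda>n. v ^ Suc n *\<^sub>R hop_kernel (Suc n) L w r) sums (v *\<^sub>R hop (green v L w) r)"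
    by (simp add: hop_scaleR hop_kernel_Suc)
  from sums_Suc[OF this]
  have "(\<lambda>n. v ^ n *\<^sub>R hop_kernel n L w r) sums (v *\<^sub>R hop (green v L w) r + delta L w r)"
    by (simp add: hop_kernel_0)
  then have "green v L w r = v *\<^sub>R hop (green v L w) r + delta L w r"
    using sums_green sums_unique2 by blast
  then show ?thesis by simp
qed

lemma green_tendsto: "(\<lambda>L. green v L w r \<bullet> w') \<longlonglongrightarrow> green v 0 w r \<bullet> w'"
  unfolding inner_green
  by (rule tendsto_eval_fps[where C = "norm w * norm w'" and R = 6])
     (use v_less kernel_fps_nth_eventually abs_kernel_fps_nth_le in auto)

lemma eval_trace_fps_tendsto: "(\<lambda>L. eval_fps (trace_fps L) v) \<longlonglongrightarrow> eval_fps (trace_fps 0) v"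
  by (rule tendsto_eval_fps[where C = 2 and R = 6])
     (use v_less trace_fps_nth_eventually abs_trace_fps_nth_le in auto)

lemma abs_green_le:
  "\<bar>green v 0 w r \<bullet> w'\<bar> \<le> norm w * norm w' * (6 * \<bar>v\<bar>) ^ nat (lattice_norm r) / (1 - 6 * \<bar>v\<bar>)"
  unfolding inner_green
  using norm_eval_fps_le_geometric_tail[of "kernel_fps 0 w w' r" "norm w * norm w'" 6
      "nat (lattice_norm r)" v]
    v_less abs_kernel_fps_nth_le
  by (simp add: kernel_fps_def hop_kernel_eq_0)

end

section \<open>The quadratic form of the model\<close>

definition quad_form :: "real \<Rightarrow> real \<Rightarrow> nat \<Rightarrow> lattice_field \<Rightarrow> lattice_field \<Rightarrow> real" where
  "quad_form \<kappa> \<tau> L f g = \<kappa> * energy L f g + \<tau> * torus_inner L f g"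

definition hopping_parameter :: "real \<Rightarrow> real \<Rightarrow> real" where
  "hopping_parameter \<kappa> \<tau> = \<kappa> / (6 * \<kappa> + \<tau>)"

definition propagator :: "real \<Rightarrow> real \<Rightarrow> nat \<Rightarrow> real \<times> real \<Rightarrow> lattice_field" where
  "propagator \<kappa> \<tau> L w r = (1 / (6 * \<kappa> + \<tau>)) *\<^sub>R green (hopping_parameter \<kappa> \<tau>) L w r"

definition mean_sq :: "real \<Rightarrow> real \<Rightarrow> nat \<Rightarrow> real" where
  "mean_sq \<kappa> \<tau> L = (\<Sum>w\<in>Basis. propagator \<kappa> \<tau> L w 0 \<bullet> w)"

lemma quad_form_commute: "quad_form \<kappa> \<tau> L f g = quad_form \<kappa> \<tau> L g f"
  by (simp add: quad_form_def energy_commute[of L f] torus_inner_commute[of L f])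

lemma quad_form_nonneg: "\<kappa> \<ge> 0 \<Longrightarrow> \<tau> \<ge> 0 \<Longrightarrow> quad_form \<kappa> \<tau> L f f \<ge> 0"
  by (simp add: quad_form_def energy_nonneg torus_inner_nonneg)

lemma quad_form_add_scaleR_left:
  "quad_form \<kappa> \<tau> L (\<lambda>r. f r + s *\<^sub>R g r) h = quad_form \<kappa> \<tau> L f h + s * quad_form \<kappa> \<tau> L g h"
  by (simp add: quad_form_def energy_add_scaleR_left torus_inner_add_scaleR_left algebra_simps)

lemma quad_form_add_scaleR_self:
  "quad_form \<kappa> \<tau> L (\<lambda>r. f r + s *\<^sub>R g r) (\<lambda>r. f r + s *\<^sub>R g r)
    = quad_form \<kappa> \<tau> L f f + 2 * s * quad_form \<kappa> \<tau> L f g + s\<^sup>2 * quad_form \<kappa> \<tau> L g g"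
proof -
  have "quad_form \<kappa> \<tau> L h (\<lambda>r. f r + s *\<^sub>R g r) = quad_form \<kappa> \<tau> L f h + s * quad_form \<kappa> \<tau> L g h" for h
    using quad_form_add_scaleR_left quad_form_commute by metis
  then show ?thesis
    using quad_form_commute[of \<kappa> \<tau> L g f]
    by (simp add: quad_form_add_scaleR_left power2_eq_square algebra_simps)
qed

lemma quad_form_eq_hop:
  assumes "L > 0" "periodic L f" "periodic L g"
  shows "quad_form \<kappa> \<tau> L f g = torus_inner L f (\<lambda>r. (6 * \<kappa> + \<tau>) *\<^sub>R g r - \<kappa> *\<^sub>R hop g r)"
proof -
  have "energy L f g = 6 * torus_inner L f g - torus_inner L f (hop g)"
    using energy_plus_hop[OF assms] by simp
  then have "quad_form \<kappa> \<tau> L f g = (6 * \<kappa> + \<tau>) * torus_inner L f g - \<kappa> * torus_inner L f (hop g)"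
    unfolding quad_form_def by (simp only:) (simp add: algebra_simps)
  then show ?thesis
    by (simp add: torus_inner_def inner_simps sum_subtractf sum_distrib_left)
qed

context
  fixes \<kappa> \<tau> :: real
  assumes \<kappa>_pos: "\<kappa> > 0" and \<tau>_pos: "\<tau> > 0"
begin

lemma hopping_parameter_pos: "hopping_parameter \<kappa> \<tau> > 0"
  using \<kappa>_pos \<tau>_pos by (simp add: hopping_parameter_def)

lemma abs_hopping_parameter_less: "\<bar>hopping_parameter \<kappa> \<tau>\<bar> < 1 / 6"
  using \<kappa>_pos \<tau>_pos by (simp add: hopping_parameter_def field_simps)

lemma periodic_propagator: "periodic L (propagator \<kappa> \<tau> L w)"
  using periodic_green[OF abs_hopping_parameter_less] by (simp add: periodic_def propagator_def)

lemma propagator_equation: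
  "(6 * \<kappa> + \<tau>) *\<^sub>R propagator \<kappa> \<tau> L w r - \<kappa> *\<^sub>R hop (propagator \<kappa> \<tau> L w) r = delta L w r"
proof -
  have "6 * \<kappa> + \<tau> \<noteq> 0" using \<kappa>_pos \<tau>_pos by simp
  then show ?thesis
    unfolding propagator_def[abs_def] hop_scaleR
    using green_equation[OF abs_hopping_parameter_less, of L w r] by (simp add: hopping_parameter_def)
qed

lemma quad_form_propagator:
  assumes "L > 0" "periodic L g"
  shows "quad_form \<kappa> \<tau> L g (\<lambda>r. propagator \<kappa> \<tau> L w (r - r\<^sub>0)) = g r\<^sub>0 \<bullet> w"
proof -
  have "quad_form \<kappa> \<tau> L g (\<lambda>r. propagator \<kappa> \<tau> L w (r - r\<^sub>0))
      = torus_inner L g (\<lambda>r. delta L w (r - r\<^sub>0))"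
    by (subst quad_form_eq_hop)
       (simp_all add: assms periodic_diff periodic_propagator hop_translate propagator_equation)
  also have "\<dots> = g r\<^sub>0 \<bullet> w"
    by (subst torus_inner_commute) (simp add: torus_inner_delta assms inner_commute)
  finally show ?thesis .
qed

lemma mean_sq_eq_eval_fps:
  "mean_sq \<kappa> \<tau> L = eval_fps (trace_fps L) (hopping_parameter \<kappa> \<tau>) / (6 * \<kappa> + \<tau>)"
  by (simp add: mean_sq_def propagator_def trace_green[OF abs_hopping_parameter_less, symmetric]
      sum_divide_distrib)

lemma mean_sq_tendsto: "mean_sq \<kappa> \<tau> \<longlonglongrightarrow> mean_sq \<kappa> \<tau> 0"
  unfolding mean_sq_eq_eval_fps[abs_def]
  by (intro tendsto_divide eval_trace_fps_tendsto abs_hopping_parameter_less tendsto_const)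
     (use \<kappa>_pos \<tau>_pos in simp)

lemma propagator_tendsto: "(\<lambda>L. propagator \<kappa> \<tau> L w r \<bullet> w') \<longlonglongrightarrow> propagator \<kappa> \<tau> 0 w r \<bullet> w'"
  unfolding propagator_def inner_scaleR_left
  by (intro tendsto_mult tendsto_const green_tendsto abs_hopping_parameter_less)

lemma abs_propagator_le:
  "\<bar>propagator \<kappa> \<tau> 0 w r \<bullet> w'\<bar>
    \<le> norm w * norm w' / \<tau> * (6 * hopping_parameter \<kappa> \<tau>) ^ nat (lattice_norm r)"
proof -
  let ?v = "hopping_parameter \<kappa> \<tau>" and ?T = "6 * \<kappa> + \<tau>"
  have T_pos: "?T > 0"
    using \<kappa>_pos \<tau>_pos by simp
  then have gap: "(1 - 6 * ?v) * ?T = \<tau>"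
    by (simp add: hopping_parameter_def field_simps)
  have "\<bar>propagator \<kappa> \<tau> 0 w r \<bullet> w'\<bar> = \<bar>green ?v 0 w r \<bullet> w'\<bar> / ?T"
    using T_pos by (simp add: propagator_def)
  also have "\<dots> \<le> norm w * norm w' * (6 * \<bar>?v\<bar>) ^ nat (lattice_norm r) / (1 - 6 * \<bar>?v\<bar>) / ?T"
    using T_pos by (intro divide_right_mono abs_green_le abs_hopping_parameter_less) simp
  also have "\<dots> = norm w * norm w' / \<tau> * (6 * ?v) ^ nat (lattice_norm r)"
    unfolding abs_of_pos[OF hopping_parameter_pos] divide_divide_eq_left gap by simp
  finally show ?thesis .
qed

end

section \<open>The Gaussian measure on the torus\<close>

definition spin_field :: "nat \<Rightarrow> config \<Rightarrow> lattice_field" where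
  "spin_field L S r = S (site_of L r)"

definition embed_site :: "site \<Rightarrow> lattice_site" where
  "embed_site s = (case s of (x, y, z) \<Rightarrow> (int x, int y, int z))"

definition gauss_weight :: "real \<Rightarrow> real \<Rightarrow> nat \<Rightarrow> config \<Rightarrow> real" where
  "gauss_weight \<kappa> \<tau> L S = exp (- quad_form \<kappa> \<tau> L (spin_field L S) (spin_field L S) / 2)"

definition gauss_partition :: "real \<Rightarrow> real \<Rightarrow> nat \<Rightarrow> real" where
  "gauss_partition \<kappa> \<tau> L = (\<integral>S. gauss_weight \<kappa> \<tau> L S \<partial>config_measure L)"

definition gauss_measure :: "real \<Rightarrow> real \<Rightarrow> nat \<Rightarrow> config measure" where
  "gauss_measure \<kappa> \<tau> L = density (config_measure L) (\<lambda>S. gauss_weight \<kappa> \<tau> L S / gauss_partition \<kappa> \<tau> L)"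

lemma finite_sites [simp]: "finite (sites L)"
  by (simp add: sites_def)

lemma card_sites: "card (sites L) = L ^ 3"
  by (simp add: sites_def card_cartesian_product power3_eq_cube)

lemma site_of_in_sites: "L > 0 \<Longrightarrow> site_of L r \<in> sites L"
  by (cases r) (auto simp: site_of_def sites_def nat_less_iff)

lemma periodic_spin_field: "periodic L (spin_field L S)"
  by (auto simp: periodic_def spin_field_def site_of_def reduce_def split: prod.splits)

lemma embed_site_of: "L > 0 \<Longrightarrow> embed_site (site_of L r) = reduce L r"
  by (cases r) (auto simp: embed_site_def site_of_def reduce_def)

lemma site_of_embed_site: "s \<in> sites L \<Longrightarrow> site_of L (embed_site s) = s"
  by (cases s) (auto simp: embed_site_def site_of_def sites_def)

lemma gauss_weight_pos: "gauss_weight \<kappa> \<tau> L S > 0"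
  by (simp add: gauss_weight_def)

lemma sets_gauss_measure [measurable_cong]: "sets (gauss_measure \<kappa> \<tau> L) = sets (config_measure L)"
  by (simp add: gauss_measure_def)

context
  fixes L :: nat
  assumes L_pos: "L > 0"
begin

lemma sum_cell_site_of: "(\<Sum>r\<in>cell L. h (site_of L r)) = (\<Sum>s\<in>sites L. h s)"
proof (rule sum.reindex_bij_witness[where i = embed_site and j = "site_of L"])
  show "embed_site (site_of L r) = r" if "r \<in> cell L" for r
    using that L_pos by (simp add: embed_site_of reduce_id)
  show "embed_site s \<in> cell L" if "s \<in> sites L" for s
    using that by (cases s) (auto simp: embed_site_def sites_def cell_def)
qed (auto simp: site_of_embed_site site_of_in_sites L_pos)

lemma torus_inner_spin_field:
  "torus_inner L (spin_field L S) (spin_field L S) = (\<Sum>s\<in>sites L. S s \<bullet> S s)"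
  unfolding torus_inner_def spin_field_def by (rule sum_cell_site_of)

lemma site_of_shift:
  "site_of L (r + (1, 0, 0)) = shift_x L (site_of L r)"
  "site_of L (r + (0, 1, 0)) = shift_y L (site_of L r)"
  "site_of L (r + (0, 0, 1)) = shift_z L (site_of L r)"
proof -
  have "nat ((a + 1) mod int L) = Suc (nat (a mod int L)) mod L" for a
  proof -
    have "int (Suc (nat (a mod int L)) mod L) = (a mod int L + 1) mod int L"
      using L_pos by (simp add: zmod_int add.commute)
    then show ?thesis by (simp add: mod_simps)
  qed
  then show "site_of L (r + (1, 0, 0)) = shift_x L (site_of L r)"
    "site_of L (r + (0, 1, 0)) = shift_y L (site_of L r)"
    "site_of L (r + (0, 0, 1)) = shift_z L (site_of L r)"
    by (cases r; simp add: site_of_def shift_x_def shift_y_def shift_z_def)+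
qed

lemma hamiltonian_eq_energy:
  "hamiltonian J L S = J / 2 * energy L (spin_field L S) (spin_field L S)"
proof -
  have bond: "bond_energy L e v (spin_field L S) (spin_field L S)
      = (\<Sum>s\<in>sites L. (S s \<bullet> v - S (shift s) \<bullet> v)\<^sup>2)"
    if "\<And>r. site_of L (r + e) = shift (site_of L r)" for e v shift
    unfolding bond_energy_def spin_field_def that
    using sum_cell_site_of[of "\<lambda>s. (S s \<bullet> v - S (shift s) \<bullet> v)\<^sup>2"]
    by (simp add: inner_diff_left power2_eq_square)
  show ?thesis
    unfolding hamiltonian_def energy_def sum_bonds prod.case
    by (simp only: bond[OF site_of_shift(1)] bond[OF site_of_shift(2)] bond[OF site_of_shift(3)]
        sum.distrib)
qed

lemma constraint_eq_torus_inner: "constraint L S = torus_inner L (spin_field L S) (spin_field L S)"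
  by (simp add: torus_inner_spin_field constraint_def inner_prod_def power2_eq_square)

lemma gibbs_weight_eq: "gibbs_weight J L \<beta> \<mu> S = gauss_weight (\<beta> * J) (2 * \<mu>) L S"
  by (simp add: gibbs_weight_def gauss_weight_def quad_form_def hamiltonian_eq_energy
      constraint_eq_torus_inner field_simps)

lemma partition_fn_eq: "partition_fn J L \<beta> \<mu> = gauss_partition (\<beta> * J) (2 * \<mu>) L"
  by (simp add: partition_fn_def gauss_partition_def gibbs_weight_eq)

lemma measurable_spin_field [measurable]: "(\<lambda>S. spin_field L S r) \<in> borel_measurable (config_measure L)"
  unfolding spin_field_def config_measure_def
  using measurable_component_singleton[OF site_of_in_sites[OF L_pos], where M = "\<lambda>_. lborel"] by simp

lemma measurable_quad_form [measurable]:
  "(\<lambda>S. quad_form \<kappa> \<tau> L f (spin_field L S)) \<in> borel_measurable (config_measure L)"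
  "(\<lambda>S. quad_form \<kappa> \<tau> L (spin_field L S) (spin_field L S)) \<in> borel_measurable (config_measure L)"
  unfolding quad_form_def energy_def sum_bonds bond_energy_def torus_inner_def prod.case by measurable

lemma measurable_gauss_weight [measurable]: "gauss_weight \<kappa> \<tau> L \<in> borel_measurable (config_measure L)"
  unfolding gauss_weight_def[abs_def] by measurable

lemma has_bochner_integral_gaussian_config:
  assumes "t > 0"
  shows "has_bochner_integral (config_measure L)
    (\<lambda>S. exp (- t * torus_inner L (spin_field L S) (spin_field L S) / 2)) ((2 * pi / t) ^ L ^ 3)"
  using has_bochner_integral_gaussian_PiM[OF finite_sites[of L] assms, where 'a = "real \<times> real"] assms
  by (simp add: torus_inner_spin_field config_measure_def card_sites)

lemma gauss_weight_bounds:
  assumes "\<kappa> \<ge> 0"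
  shows "gauss_weight \<kappa> \<tau> L S \<le> exp (- \<tau> * torus_inner L (spin_field L S) (spin_field L S) / 2)"
    "exp (- (6 * \<kappa> + \<tau>) * torus_inner L (spin_field L S) (spin_field L S) / 2) \<le> gauss_weight \<kappa> \<tau> L S"
proof -
  let ?f = "spin_field L S"
  have "\<kappa> * energy L ?f ?f \<le> \<kappa> * (6 * torus_inner L ?f ?f)" "0 \<le> \<kappa> * energy L ?f ?f"
    using assms energy_le[OF L_pos periodic_spin_field] energy_nonneg by (auto intro: mult_left_mono)
  then show "gauss_weight \<kappa> \<tau> L S \<le> exp (- \<tau> * torus_inner L ?f ?f / 2)"
    "exp (- (6 * \<kappa> + \<tau>) * torus_inner L ?f ?f / 2) \<le> gauss_weight \<kappa> \<tau> L S"
    unfolding gauss_weight_def quad_form_def exp_le_cancel_iff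
    by (simp_all add: distrib_right left_diff_distrib)
qed

lemma spin_field_translate:
  assumes "periodic L f"
  shows "spin_field L (\<lambda>s\<in>sites L. S s + t *\<^sub>R f (embed_site s)) = (\<lambda>r. spin_field L S r + t *\<^sub>R f r)"
  by (rule ext) (simp add: spin_field_def site_of_in_sites embed_site_of L_pos periodicD[OF assms])

context
  fixes \<kappa> \<tau> :: real
  assumes \<kappa>_pos: "\<kappa> > 0" and \<tau>_pos: "\<tau> > 0"
begin

lemma integrable_gauss_weight: "integrable (config_measure L) (gauss_weight \<kappa> \<tau> L)"
proof (rule Bochner_Integration.integrable_bound)
  show "integrable (config_measure L)
      (\<lambda>S. exp (- \<tau> * torus_inner L (spin_field L S) (spin_field L S) / 2))"
    using has_bochner_integral_gaussian_config[OF \<tau>_pos] by (simp add: has_bochner_integral_iff)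
  show "AE S in config_measure L. norm (gauss_weight \<kappa> \<tau> L S)
      \<le> norm (exp (- \<tau> * torus_inner L (spin_field L S) (spin_field L S) / 2))"
    using gauss_weight_bounds(1) \<kappa>_pos by (auto simp: less_imp_le gauss_weight_pos)
qed measurable

lemma gauss_partition_bounds:
  "(2 * pi / (6 * \<kappa> + \<tau>)) ^ L ^ 3 \<le> gauss_partition \<kappa> \<tau> L"
  "gauss_partition \<kappa> \<tau> L \<le> (2 * pi / \<tau>) ^ L ^ 3"
proof -
  let ?g = "\<lambda>t S. exp (- t * torus_inner L (spin_field L S) (spin_field L S) / 2)"
  have T_pos: "6 * \<kappa> + \<tau> > 0" and \<kappa>_nonneg: "\<kappa> \<ge> 0"
    using \<kappa>_pos \<tau>_pos by simp_all
  have integrable: "integrable (config_measure L) (?g t)"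
    and integral: "(\<integral>S. ?g t S \<partial>config_measure L) = (2 * pi / t) ^ L ^ 3" if "t > 0" for t
    using has_bochner_integral_gaussian_config[OF that] by (simp_all only: has_bochner_integral_iff)
  show "(2 * pi / (6 * \<kappa> + \<tau>)) ^ L ^ 3 \<le> gauss_partition \<kappa> \<tau> L"
    unfolding integral[OF T_pos, symmetric] gauss_partition_def
    by (intro integral_mono integrable T_pos integrable_gauss_weight gauss_weight_bounds(2) \<kappa>_nonneg)
  show "gauss_partition \<kappa> \<tau> L \<le> (2 * pi / \<tau>) ^ L ^ 3"
    unfolding integral[OF \<tau>_pos, symmetric] gauss_partition_def
    by (intro integral_mono integrable \<tau>_pos integrable_gauss_weight gauss_weight_bounds(1) \<kappa>_nonneg)
qed

lemma gauss_partition_pos: "gauss_partition \<kappa> \<tau> L > 0"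
proof -
  have "0 < (2 * pi / (6 * \<kappa> + \<tau>)) ^ L ^ 3" using \<kappa>_pos \<tau>_pos by simp
  then show ?thesis using gauss_partition_bounds(1) by linarith
qed

lemma has_bochner_integral_gauss_weight:
  "has_bochner_integral (config_measure L) (gauss_weight \<kappa> \<tau> L) (gauss_partition \<kappa> \<tau> L)"
  by (simp add: has_bochner_integral_iff integrable_gauss_weight gauss_partition_def)

lemma has_bochner_integral_gauss_measure:
  assumes [measurable]: "F \<in> borel_measurable (config_measure L)"
    and integral: "has_bochner_integral (config_measure L) (\<lambda>S. gauss_weight \<kappa> \<tau> L S * F S)
        (x * gauss_partition \<kappa> \<tau> L)"
  shows "has_bochner_integral (gauss_measure \<kappa> \<tau> L) F x"
  unfolding gauss_measure_def
proof (rule has_bochner_integral_density)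
  show "AE S in config_measure L. 0 \<le> gauss_weight \<kappa> \<tau> L S / gauss_partition \<kappa> \<tau> L"
    using gauss_weight_pos gauss_partition_pos by (simp add: less_imp_le)
  show "has_bochner_integral (config_measure L)
      (\<lambda>S. (gauss_weight \<kappa> \<tau> L S / gauss_partition \<kappa> \<tau> L) *\<^sub>R F S) x"
    using has_bochner_integral_divide_zero[OF integral, of "gauss_partition \<kappa> \<tau> L"] gauss_partition_pos by simp
qed measurable

lemma integral_gauss_measure:
  assumes "F \<in> borel_measurable (config_measure L)"
  shows "(\<integral>S. F S \<partial>gauss_measure \<kappa> \<tau> L)
    = (\<integral>S. F S * gauss_weight \<kappa> \<tau> L S \<partial>config_measure L) / gauss_partition \<kappa> \<tau> L"
  unfolding gauss_measure_def using assms gauss_weight_pos gauss_partition_pos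
  by (subst integral_density) (simp_all add: less_imp_le mult.commute)

lemma prob_space_gauss_measure: "prob_space (gauss_measure \<kappa> \<tau> L)"
proof (rule prob_spaceI)
  let ?p = "\<lambda>S. gauss_weight \<kappa> \<tau> L S / gauss_partition \<kappa> \<tau> L"
  have "has_bochner_integral (config_measure L) ?p 1"
    using has_bochner_integral_divide_zero[OF has_bochner_integral_gauss_weight,
        of "gauss_partition \<kappa> \<tau> L"]
      gauss_partition_pos by simp
  then have "integrable (config_measure L) ?p" "(\<integral>S. ?p S \<partial>config_measure L) = 1"
    by (simp_all only: has_bochner_integral_iff)
  then have "(\<integral>\<^sup>+S. ?p S \<partial>config_measure L) = 1"
    using nn_integral_eq_integral[of "config_measure L" ?p] gauss_weight_pos[of \<kappa> \<tau> L]
        gauss_partition_pos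
    by (simp only: ennreal_1) (simp add: less_imp_le)
  then show "emeasure (gauss_measure \<kappa> \<tau> L) (space (gauss_measure \<kappa> \<tau> L)) = 1"
    by (simp add: gauss_measure_def emeasure_density cong: nn_integral_cong)
qed

lemma gauss_moment_generating_function:
  assumes periodic: "periodic L f"
  shows "has_bochner_integral (gauss_measure \<kappa> \<tau> L)
    (\<lambda>S. exp (t * quad_form \<kappa> \<tau> L f (spin_field L S))) (exp (t\<^sup>2 * quad_form \<kappa> \<tau> L f f / 2))"
proof -
  let ?M = "config_measure L" and ?Q = "quad_form \<kappa> \<tau> L" and ?w = "gauss_weight \<kappa> \<tau> L"
  define T where "T S = (\<lambda>s\<in>sites L. S s + (- t) *\<^sub>R f (embed_site s))" for S
  have weight_T: "?w (T S) = exp (- (t\<^sup>2 * ?Q f f / 2)) * (?w S * exp (t * ?Q f (spin_field L S)))"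
      for S
    unfolding gauss_weight_def T_def spin_field_translate[OF periodic] quad_form_add_scaleR_self
    by (simp add: quad_form_commute[of \<kappa> \<tau> L "spin_field L S" f] field_simps flip: exp_add)
  have "T \<in> ?M \<rightarrow>\<^sub>M ?M"
    unfolding T_def[abs_def] config_measure_def by (intro measurable_restrict) measurable
  moreover have "distr ?M ?M T = ?M"
    unfolding T_def[abs_def] config_measure_def by (intro distr_PiM_lborel_translate finite_sites)
  ultimately have "has_bochner_integral ?M (\<lambda>S. ?w (T S)) (gauss_partition \<kappa> \<tau> L)"
    using has_bochner_integral_gauss_weight by (rule has_bochner_integral_distr_invariant)
  then have "has_bochner_integral ?M (\<lambda>S. exp (t\<^sup>2 * ?Q f f / 2) * ?w (T S))
      (exp (t\<^sup>2 * ?Q f f / 2) * gauss_partition \<kappa> \<tau> L)"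
    by (rule has_bochner_integral_mult_right)
  moreover have "exp (t\<^sup>2 * ?Q f f / 2) * ?w (T S) = ?w S * exp (t * ?Q f (spin_field L S))" for S
    by (simp add: weight_T exp_minus)
  ultimately show ?thesis
    by (intro has_bochner_integral_gauss_measure) (simp_all add: mult.commute)
qed

lemma quad_form_second_moment:
  assumes "periodic L f"
  shows "has_bochner_integral (gauss_measure \<kappa> \<tau> L)
    (\<lambda>S. (quad_form \<kappa> \<tau> L f (spin_field L S))\<^sup>2) (quad_form \<kappa> \<tau> L f f)"
  by (intro second_moment_of_gaussian_mgf gauss_moment_generating_function assms)

text \<open>By polarization of the second moments of the propagators of the two point sources.\<close>

lemma covariance:
  "has_bochner_integral (gauss_measure \<kappa> \<tau> L)
    (\<lambda>S. (spin_field L S r\<^sub>0 \<bullet> w\<^sub>0) * (spin_field L S r\<^sub>1 \<bullet> w\<^sub>1))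
        (propagator \<kappa> \<tau> L w\<^sub>1 (r\<^sub>0 - r\<^sub>1) \<bullet> w\<^sub>0)"
proof -
  let ?Q = "quad_form \<kappa> \<tau> L"
  define f where "f r = propagator \<kappa> \<tau> L w\<^sub>0 (r - r\<^sub>0)" for r
  define g where "g r = propagator \<kappa> \<tau> L w\<^sub>1 (r - r\<^sub>1)" for r
  have periodic: "periodic L f" "periodic L g"
    unfolding f_def g_def by (intro periodic_diff periodic_propagator \<kappa>_pos \<tau>_pos)+
  then have combination: "periodic L (\<lambda>r. f r + s *\<^sub>R g r)" for s
    by (simp add: periodic_def)
  have source: "?Q f h = h r\<^sub>0 \<bullet> w\<^sub>0" "?Q g h = h r\<^sub>1 \<bullet> w\<^sub>1" if "periodic L h" for h
    unfolding f_def g_def using quad_form_propagator[OF \<kappa>_pos \<tau>_pos L_pos that] quad_form_commute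
    by metis+
  have "has_bochner_integral (gauss_measure \<kappa> \<tau> L)
      (\<lambda>S. (spin_field L S r\<^sub>0 \<bullet> w\<^sub>0 + s * (spin_field L S r\<^sub>1 \<bullet> w\<^sub>1))\<^sup>2)
      (?Q f f + 2 * s * (g r\<^sub>0 \<bullet> w\<^sub>0) + s\<^sup>2 * ?Q g g)" for s
    using quad_form_second_moment[OF combination[of s]]
    unfolding quad_form_add_scaleR_self quad_form_add_scaleR_left
    by (simp add: source periodic periodic_spin_field)
  from has_bochner_integral_divide_zero[OF
      has_bochner_integral_diff[OF this[of 1] this[of "- 1"]], of 4]
  show ?thesis
    by (simp add: g_def power2_eq_square algebra_simps)
qed

lemma constraint_moment:
  "has_bochner_integral (gauss_measure \<kappa> \<tau> L) (constraint L) (real L ^ 3 * mean_sq \<kappa> \<tau> L)"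
proof -
  have "has_bochner_integral (gauss_measure \<kappa> \<tau> L)
      (\<lambda>S. \<Sum>r\<in>cell L. \<Sum>w\<in>Basis. (spin_field L S r \<bullet> w) * (spin_field L S r \<bullet> w))
      (\<Sum>r\<in>cell L. \<Sum>w\<in>Basis. propagator \<kappa> \<tau> L w (r - r) \<bullet> w)"
    by (intro has_bochner_integral_sum covariance)
  then show ?thesis
    unfolding euclidean_inner[symmetric] torus_inner_def[symmetric] constraint_eq_torus_inner[symmetric]
    by (simp add: mean_sq_def card_cell)
qed

text \<open>The total spin is the form of a constant field, which has no energy.\<close>

lemma total_spin_moment:
  "has_bochner_integral (gauss_measure \<kappa> \<tau> L) (\<lambda>S. (norm (\<Sum>s\<in>sites L. S s))\<^sup>2) (2 * real L ^ 3 / \<tau>)"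
proof -
  have component: "has_bochner_integral (gauss_measure \<kappa> \<tau> L) (\<lambda>S. ((\<Sum>s\<in>sites L. S s) \<bullet> w)\<^sup>2)
      (real L ^ 3 / \<tau>)"
    if w: "w \<in> Basis" for w
  proof -
    have form: "quad_form \<kappa> \<tau> L (\<lambda>_. w) g = \<tau> * torus_inner L (\<lambda>_. w) g" for g
      by (simp add: quad_form_def energy_def bond_energy_def)
    have "torus_inner L (\<lambda>_. w) (spin_field L S) = (\<Sum>s\<in>sites L. S s) \<bullet> w" for S
      unfolding torus_inner_def spin_field_def
      using sum_cell_site_of[of "\<lambda>s. w \<bullet> S s"] by (simp add: inner_sum_right inner_commute)
    moreover have "torus_inner L (\<lambda>_. w) (\<lambda>_. w) = real L ^ 3"
      using w by (simp add: torus_inner_def card_cell)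
    ultimately have "has_bochner_integral (gauss_measure \<kappa> \<tau> L)
        (\<lambda>S. (\<tau> * ((\<Sum>s\<in>sites L. S s) \<bullet> w))\<^sup>2) (\<tau> * real L ^ 3)"
      using quad_form_second_moment[of "\<lambda>_. w"] by (simp add: form periodic_def)
    from has_bochner_integral_divide_zero[OF this, of "\<tau>\<^sup>2"] show ?thesis
      using \<tau>_pos by (simp add: power_mult_distrib power2_eq_square)
  qed
  have "(norm X)\<^sup>2 = (\<Sum>w\<in>Basis. (X \<bullet> w)\<^sup>2)" for X :: "real \<times> real"
    unfolding power2_norm_eq_inner by (subst euclidean_inner) (simp add: power2_eq_square)
  moreover have "has_bochner_integral (gauss_measure \<kappa> \<tau> L) (\<lambda>S. \<Sum>w\<in>Basis. ((\<Sum>s\<in>sites L. S s) \<bullet> w)\<^sup>2)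
      (\<Sum>w\<in>(Basis :: (real \<times> real) set). real L ^ 3 / \<tau>)"
    by (intro has_bochner_integral_sum component)
  ultimately show ?thesis
    by simp
qed

end

lemma gibbs_expectation:
  assumes "\<beta> * J > 0" "2 * \<mu> > 0" and mean: "has_bochner_integral (gauss_measure (\<beta> * J) (2 * \<mu>) L) F x"
  shows "gibbs_expect J L \<beta> \<mu> F = x"
proof -
  have "F \<in> borel_measurable (config_measure L)"
    using borel_measurable_has_bochner_integral[OF mean]
    by (simp cong: measurable_cong_sets add: sets_gauss_measure)
  then have "gibbs_expect J L \<beta> \<mu> F = (\<integral>S. F S \<partial>gauss_measure (\<beta> * J) (2 * \<mu>) L)"
    using assms(1,2) by (simp add: gibbs_expect_def gibbs_weight_eq partition_fn_eq
        integral_gauss_measure)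
  then show ?thesis
    using mean by (simp add: has_bochner_integral_iff)
qed

end

section \<open>Unboundedness of the mean square spin\<close>

lemma propagator_diag_nonneg:
  assumes "\<kappa> > 0" "\<tau> > 0" "L > 0"
  shows "propagator \<kappa> \<tau> L w 0 \<bullet> w \<ge> 0"
proof -
  have "periodic L (propagator \<kappa> \<tau> L w)"
    by (rule periodic_propagator[OF assms(1,2)])
  then have "quad_form \<kappa> \<tau> L (propagator \<kappa> \<tau> L w) (propagator \<kappa> \<tau> L w) = propagator \<kappa> \<tau> L w 0 \<bullet> w"
    using quad_form_propagator[OF assms, of _ w 0] by simp
  then show ?thesis
    using quad_form_nonneg[of \<kappa> \<tau> L] assms by (metis less_imp_le)
qed

lemma inner_square_le_quad_form:
  assumes "\<kappa> > 0" "\<tau> > 0" "L > 0" "periodic L f"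
  shows "(f r \<bullet> w)\<^sup>2 \<le> quad_form \<kappa> \<tau> L f f * (propagator \<kappa> \<tau> L w 0 \<bullet> w)"
proof (rule square_le_mult_of_quadratic_nonneg)
  define g where "g s = propagator \<kappa> \<tau> L w (s - r)" for s
  have "periodic L g"
    unfolding g_def by (intro periodic_diff periodic_propagator assms)
  have "quad_form \<kappa> \<tau> L h g = h r \<bullet> w" if "periodic L h" for h
    unfolding g_def by (rule quad_form_propagator[OF assms(1-3) that])
  then have forms: "quad_form \<kappa> \<tau> L f g = f r \<bullet> w" "quad_form \<kappa> \<tau> L g g = propagator \<kappa> \<tau> L w 0 \<bullet> w"
    using assms(4) \<open>periodic L g\<close> by (simp_all add: g_def)
  show "propagator \<kappa> \<tau> L w 0 \<bullet> w \<ge> 0"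
    by (rule propagator_diag_nonneg[OF assms(1-3)])
  show "quad_form \<kappa> \<tau> L f f + 2 * s * (f r \<bullet> w) + s\<^sup>2 * (propagator \<kappa> \<tau> L w 0 \<bullet> w) \<ge> 0" for s
    using quad_form_nonneg[of \<kappa> \<tau> L "\<lambda>r. f r + s *\<^sub>R g r"] assms
    by (simp add: quad_form_add_scaleR_self forms)
qed

definition circle_dist :: "nat \<Rightarrow> int \<Rightarrow> nat" where
  "circle_dist L x = nat (min (x mod int L) (int L - x mod int L))"

definition plane_dist :: "nat \<Rightarrow> int \<Rightarrow> int \<Rightarrow> nat" where
  "plane_dist L y z = max (circle_dist L y) (circle_dist L z)"

lemma circle_dist_mod [simp]: "circle_dist L (x mod int L) = circle_dist L x"
  by (simp add: circle_dist_def)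

lemma circle_dist_0 [simp]: "circle_dist L 0 = 0"
  by (simp add: circle_dist_def)

lemma circle_dist_add_one:
  assumes "L > 0"
  shows "circle_dist L (x + 1) \<le> circle_dist L x + 1" "circle_dist L x \<le> circle_dist L (x + 1) + 1"
proof -
  define m where "m = x mod int L"
  have m_range: "0 \<le> m" "m < int L"
    using assms by (auto simp: m_def)
  have "(x + 1) mod int L = (m + 1) mod int L"
    by (simp add: m_def mod_simps)
  also have "\<dots> = (if m + 1 = int L then 0 else m + 1)"
    using m_range by auto
  finally show "circle_dist L (x + 1) \<le> circle_dist L x + 1"
    "circle_dist L x \<le> circle_dist L (x + 1) + 1"
    using m_range by (auto simp: circle_dist_def m_def[symmetric])
qed

lemma plane_dist_add_one:
  assumes "L > 0"
  shows "plane_dist L (y + 1) z \<le> plane_dist L y z + 1" "plane_dist L y z \<le> plane_dist L (y + 1) z + 1"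
    "plane_dist L y (z + 1) \<le> plane_dist L y z + 1" "plane_dist L y z \<le> plane_dist L y (z + 1) + 1"
  using circle_dist_add_one[OF assms, of y] circle_dist_add_one[OF assms, of z]
  by (auto simp: plane_dist_def)

lemma sum_circle_dist_le:
  fixes F :: "nat \<Rightarrow> real"
  assumes F_nonneg_support: "\<And>a. F a \<ge> 0" "\<And>a. a > K \<Longrightarrow> F a = 0"
  shows "(\<Sum>y\<in>{0..<int L}. F (circle_dist L y)) \<le> 2 * (\<Sum>a\<le>K. F a)"
proof -
  have sum_le: "(\<Sum>a\<in>A. F a) \<le> (\<Sum>a\<le>K. F a)" if "finite A" for A
  proof -
    have "(\<Sum>a\<in>A. F a) = (\<Sum>a\<in>A \<inter> {..K}. F a)"
      using that F_nonneg_support(2) not_le by (intro sum.mono_neutral_right) blast+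
    also have "\<dots> \<le> (\<Sum>a\<le>K. F a)"
      using F_nonneg_support(1) by (intro sum_mono2) auto
    finally show ?thesis .
  qed
  have "F (circle_dist L y) \<le> F (nat y) + F (L - nat y)" if "y \<in> {0..<int L}" for y
  proof -
    have "circle_dist L y = nat y \<or> circle_dist L y = L - nat y"
      using that by (auto simp: circle_dist_def min_def nat_diff_distrib)
    then show ?thesis
      using F_nonneg_support(1)[of "nat y"] F_nonneg_support(1)[of "L - nat y"] by auto
  qed
  then have "(\<Sum>y\<in>{0..<int L}. F (circle_dist L y)) \<le> (\<Sum>y\<in>{0..<int L}. F (nat y) + F (L - nat y))"
    by (rule sum_mono)
  also have "\<dots> = (\<Sum>a\<in>nat ` {0..<int L}. F a) + (\<Sum>a\<in>(\<lambda>y. L - nat y) ` {0..<int L}. F a)"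
    by (subst (1 2) sum.reindex) (auto simp: inj_on_def sum.distrib)
  also have "\<dots> \<le> (\<Sum>a\<le>K. F a) + (\<Sum>a\<le>K. F a)"
    by (intro add_mono sum_le) auto
  finally show ?thesis by simp
qed

lemma sum_max_le:
  fixes F :: "nat \<Rightarrow> real"
  assumes F_nonneg: "\<And>a. F a \<ge> 0"
  shows "(\<Sum>a\<le>K. \<Sum>b\<le>K. F (max a b)) \<le> (\<Sum>k\<le>K. 2 * real (Suc k) * F k)"
proof (induction K)
  case (Suc K)
  have "(\<Sum>a\<le>Suc K. \<Sum>b\<le>Suc K. F (max a b)) =
     (\<Sum>a\<le>K. \<Sum>b\<le>K. F (max a b)) + (\<Sum>a\<le>K. F (Suc K)) + (\<Sum>b\<le>K. F (Suc K)) + F (Suc K)"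
    by (simp add: sum.distrib max_def algebra_simps)
  also have "\<dots> \<le> (\<Sum>k\<le>K. 2 * real (Suc k) * F k) + 2 * real (Suc (Suc K)) * F (Suc K)"
    using Suc F_nonneg[of "Suc K"] by (simp add: algebra_simps)
  finally show ?case by simp
qed (use F_nonneg[of 0] in simp)

lemma sum_plane_dist_le:
  fixes F :: "nat \<Rightarrow> real"
  assumes F_nonneg_support: "\<And>a. F a \<ge> 0" "\<And>a. a > K \<Longrightarrow> F a = 0"
  shows "(\<Sum>y\<in>{0..<int L}. \<Sum>z\<in>{0..<int L}. F (plane_dist L y z)) \<le> 8 * (\<Sum>k\<le>K. real (Suc k) * F k)"
proof -
  let ?I = "{0..<int L}"
  have "(\<Sum>y\<in>?I. \<Sum>z\<in>?I. F (plane_dist L y z)) \<le> 2 * (\<Sum>a\<le>K. \<Sum>z\<in>?I. F (max a (circle_dist L z)))"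
    unfolding plane_dist_def
    by (rule sum_circle_dist_le[where F = "\<lambda>a. \<Sum>z\<in>?I. F (max a (circle_dist L z))"])
       (auto intro!: sum_nonneg sum.neutral F_nonneg_support)
  also have "\<dots> \<le> 2 * (\<Sum>a\<le>K. 2 * (\<Sum>b\<le>K. F (max a b)))"
    by (intro mult_left_mono sum_mono sum_circle_dist_le[where F = "\<lambda>b. F (max _ b)"]) (auto intro!: F_nonneg_support)
  also have "\<dots> = 4 * (\<Sum>a\<le>K. \<Sum>b\<le>K. F (max a b))"
    by (simp add: sum_distrib_left)
  also have "\<dots> \<le> 4 * (\<Sum>k\<le>K. 2 * real (Suc k) * F k)"
    by (intro mult_left_mono sum_max_le F_nonneg_support) auto
  also have "\<dots> = 8 * (\<Sum>k\<le>K. real (Suc k) * F k)"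
    by (simp add: sum_distrib_left algebra_simps)
  finally show ?thesis .
qed

lemma sum_cell_plane_le:
  fixes F :: "nat \<Rightarrow> real"
  assumes "L > 0" and F_nonneg_support: "\<And>a. F a \<ge> 0" "\<And>a. a > K \<Longrightarrow> F a = 0"
  shows "(\<Sum>(x, y, z)\<in>cell L. if x mod int L = 0 then F (plane_dist L y z) else 0)
    \<le> 8 * (\<Sum>k\<le>K. real (Suc k) * F k)"
proof -
  let ?I = "{0..<int L}"
  have "(\<Sum>(x, y, z)\<in>cell L. if x mod int L = 0 then F (plane_dist L y z) else 0)
     = (\<Sum>x\<in>?I. \<Sum>y\<in>?I. \<Sum>z\<in>?I. if x mod int L = 0 then F (plane_dist L y z) else 0)"
    by (simp only: cell_def sum.cartesian_product)
  also have "\<dots> = (\<Sum>x\<in>?I. if x = 0 then (\<Sum>y\<in>?I. \<Sum>z\<in>?I. F (plane_dist L y z)) else 0)"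
    by (intro sum.cong) auto
  also have "\<dots> = (\<Sum>y\<in>?I. \<Sum>z\<in>?I. F (plane_dist L y z))"
    using assms(1) by (subst sum.delta) auto
  also have "\<dots> \<le> 8 * (\<Sum>k\<le>K. real (Suc k) * F k)"
    by (rule sum_plane_dist_le[OF F_nonneg_support])
  finally show ?thesis .
qed

definition cutoff :: "nat \<Rightarrow> nat \<Rightarrow> real" where
  "cutoff N k = max 0 (1 - harm k / harm N)"

definition cutoff_slope :: "nat \<Rightarrow> nat \<Rightarrow> real" where
  "cutoff_slope N k = (if k \<le> N then 2 / (real (Suc k) * harm N) else 0)"

lemma cutoff_0 [simp]: "cutoff N 0 = 1"
  by (simp add: cutoff_def harm_def)

lemma cutoff_nonneg: "0 \<le> cutoff N k"
  by (simp add: cutoff_def)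

lemma cutoff_le_1: "cutoff N k \<le> 1"
  by (simp add: cutoff_def harm_nonneg)

lemma cutoff_eq_0: "N > 0 \<Longrightarrow> N \<le> k \<Longrightarrow> cutoff N k = 0"
  using harm_mono[of N k, where 'a = real] harm_pos[of N, where 'a = real]
  by (auto simp: cutoff_def field_simps)

lemma abs_harm_diff_le:
  assumes "j \<le> k + 1" "k \<le> j + 1"
  shows "\<bar>harm k - harm j :: real\<bar> \<le> 2 / real (Suc k)"
proof -
  consider "j = k" | "j = Suc k" | "k = Suc j"
    using assms by linarith
  then show ?thesis
    by cases (simp_all add: harm_Suc field_simps)
qed

lemma abs_cutoff_diff_le:
  assumes "N > 0" "j \<le> k + 1" "k \<le> j + 1"
  shows "\<bar>cutoff N k - cutoff N j\<bar> \<le> cutoff_slope N k"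
proof (cases "k \<le> N")
  case True
  have "\<bar>cutoff N k - cutoff N j\<bar> \<le> \<bar>harm k / harm N - harm j / harm N\<bar>"
    unfolding cutoff_def by linarith
  also have "\<dots> = \<bar>harm k - harm j\<bar> / harm N"
    by (simp add: abs_divide harm_nonneg flip: diff_divide_distrib)
  also have "\<dots> \<le> 2 / real (Suc k) / harm N"
    using assms by (intro divide_right_mono abs_harm_diff_le) (auto simp: harm_nonneg)
  finally show ?thesis
    using True by (simp add: cutoff_slope_def)
next
  case False
  then show ?thesis
    using assms by (simp add: cutoff_eq_0 cutoff_slope_def)
qed

lemma sum_cutoff_slope_le:
  assumes "N > 0"
  shows "(\<Sum>k\<le>N. real (Suc k) * (cutoff_slope N k)\<^sup>2) \<le> 8 / harm N"
proof -
  let ?H = "harm N :: real"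
  have harm_ge_1: "?H \<ge> 1"
    using harm_mono[of 1 N, where 'a = real] assms by (simp add: harm_def)
  have "(\<Sum>k\<le>N. real (Suc k) * (cutoff_slope N k)\<^sup>2) = (\<Sum>k\<le>N. inverse (real (Suc k)) * (4 / ?H\<^sup>2))"
    by (intro sum.cong) (auto simp: cutoff_slope_def power2_eq_square divide_simps simp del: of_nat_Suc)
  also have "\<dots> = harm (Suc N) * (4 / ?H\<^sup>2)"
    unfolding harm_def sum_distrib_right
    by (intro sum.reindex_bij_witness[where i = "\<lambda>k. k - 1" and j = Suc]) auto
  also have "\<dots> \<le> (2 * ?H) * (4 / ?H\<^sup>2)"
  proof (intro mult_right_mono)
    have "inverse (real (Suc N)) \<le> 1"
      by (simp add: field_simps)
    then show "harm (Suc N) \<le> 2 * ?H"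
      using harm_ge_1 by (simp add: harm_Suc)
  qed simp
  also have "\<dots> = 8 / ?H"
    using harm_ge_1 by (simp add: power2_eq_square)
  finally show ?thesis .
qed

text \<open>The trial field lives on the plane \<open>x = 0\<close> and points in the direction \<open>(0, 1)\<close> orthogonal to
  \<open>vec_a\<close>, so that it only costs the two-dimensional Dirichlet energy of the logarithmic cutoff.\<close>

definition trial_field :: "nat \<Rightarrow> nat \<Rightarrow> lattice_field" where
  "trial_field N L r = (case r of (x, y, z) \<Rightarrow>
     (0, if x mod int L = 0 then cutoff N (plane_dist L y z) else 0))"

lemma periodic_trial_field: "periodic L (trial_field N L)"
  by (auto simp: periodic_def trial_field_def reduce_def plane_dist_def)

lemma trial_field_0: "trial_field N L 0 = (0, 1)"
  by (simp add: trial_field_def zero_prod_def plane_dist_def)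

lemma bond_energy_trial_field_le:
  assumes "N > 0" "L > 0" and v_le: "(snd v)\<^sup>2 \<le> 1"
    and near: "\<And>y z. plane_dist L (y + b) (z + c) \<le> plane_dist L y z + 1"
      "\<And>y z. plane_dist L y z \<le> plane_dist L (y + b) (z + c) + 1"
  shows "bond_energy L (0, b, c) v (trial_field N L) (trial_field N L) \<le> 64 / harm N"
proof -
  let ?f = "trial_field N L"
  have "bond_energy L (0, b, c) v ?f ?f
      \<le> (\<Sum>(x, y, z)\<in>cell L. if x mod int L = 0 then (cutoff_slope N (plane_dist L y z))\<^sup>2 else 0)"
    unfolding bond_energy_def
  proof (intro sum_mono, clarify)
    fix x y z
    let ?k = "plane_dist L y z" and ?j = "plane_dist L (y + b) (z + c)"
    have "(cutoff N ?k - cutoff N ?j)\<^sup>2 \<le> (cutoff_slope N ?k)\<^sup>2"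
      using power_mono[OF abs_cutoff_diff_le[OF assms(1) near(1)[of y z] near(2)[of y z]], of 2] by simp
    then have "(cutoff N ?k - cutoff N ?j)\<^sup>2 * (snd v)\<^sup>2 \<le> (cutoff_slope N ?k)\<^sup>2 * 1"
      using v_le by (intro mult_mono) auto
    then show "((?f (x, y, z) - ?f ((x, y, z) + (0, b, c))) \<bullet> v)
        * ((?f (x, y, z) - ?f ((x, y, z) + (0, b, c))) \<bullet> v)
       \<le> (if x mod int L = 0 then (cutoff_slope N ?k)\<^sup>2 else 0)"
      by (simp add: trial_field_def inner_prod_def power2_eq_square algebra_simps)
  qed
  also have "\<dots> \<le> 8 * (\<Sum>k\<le>N. real (Suc k) * (cutoff_slope N k)\<^sup>2)"
    by (rule sum_cell_plane_le[OF assms(2)]) (auto simp: cutoff_slope_def)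
  also have "\<dots> \<le> 64 / harm N"
    using sum_cutoff_slope_le[OF assms(1)] by simp
  finally show ?thesis .
qed

lemma energy_trial_field_le:
  assumes "N > 0" "L > 0"
  shows "energy L (trial_field N L) (trial_field N L) \<le> 128 / harm N"
proof -
  let ?E = "\<lambda>e v. bond_energy L e v (trial_field N L) (trial_field N L)"
  have "?E (1, 0, 0) vec_a = 0"
    unfolding bond_energy_def
    by (intro sum.neutral) (auto simp: trial_field_def vec_a_def inner_prod_def split: prod.splits)
  moreover have "?E (0, 1, 0) vec_b \<le> 64 / harm N"
    using plane_dist_add_one[OF assms(2)]
    by (intro bond_energy_trial_field_le assms) (auto simp: vec_b_def power_divide)
  moreover have "?E (0, 0, 1) vec_c \<le> 64 / harm N"
    using plane_dist_add_one[OF assms(2)]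
    by (intro bond_energy_trial_field_le assms) (auto simp: vec_c_def power_divide)
  ultimately show ?thesis
    by (simp add: energy_def sum_bonds)
qed

lemma torus_inner_trial_field_le:
  assumes "N > 0" "L > 0"
  shows "torus_inner L (trial_field N L) (trial_field N L) \<le> 8 * (\<Sum>k\<le>N. real (Suc k))"
proof -
  let ?F = "\<lambda>k. if k \<le> N then 1 else 0 :: real"
  have cutoff_square: "cutoff N k * cutoff N k \<le> ?F k" for k
    using cutoff_nonneg[of N k] cutoff_le_1[of N k] assms by (auto intro: mult_le_one simp: cutoff_eq_0)
  have "torus_inner L (trial_field N L) (trial_field N L)
      \<le> (\<Sum>(x, y, z)\<in>cell L. if x mod int L = 0 then ?F (plane_dist L y z) else 0)"
    unfolding torus_inner_def
    by (intro sum_mono) (use cutoff_square in \<open>auto simp: trial_field_def inner_prod_def\<close>)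
  also have "\<dots> \<le> 8 * (\<Sum>k\<le>N. real (Suc k) * ?F k)"
    by (rule sum_cell_plane_le[OF assms(2)]) auto
  also have "(\<Sum>k\<le>N. real (Suc k) * ?F k) = (\<Sum>k\<le>N. real (Suc k))"
    by (intro sum.cong) auto
  finally show ?thesis .
qed

lemma mean_sq_mult_trial_form_ge:
  assumes "\<kappa> > 0" "\<tau> > 0" "L > 0" "N > 0"
  shows "1 \<le> (\<kappa> * (128 / harm N) + \<tau> * (8 * (\<Sum>k\<le>N. real (Suc k)))) * mean_sq \<kappa> \<tau> L"
proof -
  let ?f = "trial_field N L" and ?e = "(0, 1) :: real \<times> real"
  have "1 \<le> quad_form \<kappa> \<tau> L ?f ?f * (propagator \<kappa> \<tau> L ?e 0 \<bullet> ?e)"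
    using inner_square_le_quad_form[OF assms(1-3) periodic_trial_field, of N 0 ?e]
    by (simp add: trial_field_0)
  also have "\<dots> \<le> (\<kappa> * (128 / harm N) + \<tau> * (8 * (\<Sum>k\<le>N. real (Suc k)))) * mean_sq \<kappa> \<tau> L"
  proof (intro mult_mono)
    show "quad_form \<kappa> \<tau> L ?f ?f \<le> \<kappa> * (128 / harm N) + \<tau> * (8 * (\<Sum>k\<le>N. real (Suc k)))"
      unfolding quad_form_def using assms
      by (intro add_mono mult_left_mono energy_trial_field_le torus_inner_trial_field_le) auto
    show "propagator \<kappa> \<tau> L ?e 0 \<bullet> ?e \<le> mean_sq \<kappa> \<tau> L"
      unfolding mean_sq_def using assms
      by (intro member_le_sum propagator_diag_nonneg) (auto simp: Basis_prod_def)
    show "0 \<le> \<kappa> * (128 / harm N) + \<tau> * (8 * (\<Sum>k\<le>N. real (Suc k)))"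
      using assms harm_nonneg[of N, where 'a = real] by (simp add: sum_nonneg)
    show "0 \<le> propagator \<kappa> \<tau> L ?e 0 \<bullet> ?e"
      using assms by (intro propagator_diag_nonneg)
  qed
  finally show ?thesis .
qed

lemma trial_form_bound_le:
  assumes "\<kappa> > 0" "\<epsilon> > 0"
  shows "\<exists>N>0. \<exists>\<tau>>0. \<kappa> * (128 / harm N) + \<tau> * (8 * (\<Sum>k\<le>N. real (Suc k))) \<le> \<epsilon>"
proof -
  have "(\<lambda>N. \<kappa> * (128 / harm N)) \<longlonglongrightarrow> \<kappa> * 0"
    by (intro tendsto_mult tendsto_const tendsto_divide_0[OF tendsto_const]
        filterlim_at_top_imp_at_infinity harm_at_top)
  then have "\<forall>\<^sub>F N in sequentially. \<kappa> * (128 / harm N) < \<epsilon> / 2"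
    by (rule order_tendstoD) (use assms in simp)
  then have "\<forall>\<^sub>F N in sequentially. \<kappa> * (128 / harm N) < \<epsilon> / 2 \<and> N > 0"
    using eventually_gt_at_top[of 0] by (rule eventually_conj)
  then obtain N where N_bound: "\<kappa> * (128 / harm N) < \<epsilon> / 2" "N > 0"
    using eventually_happens'[OF sequentially_bot] by blast
  define C where "C = 8 * (\<Sum>k\<le>N. real (Suc k))"
  have "C > 0"
    unfolding C_def by (intro mult_pos_pos sum_pos) auto
  then have "\<epsilon> / (2 * C) > 0" "\<kappa> * (128 / harm N) + \<epsilon> / (2 * C) * C \<le> \<epsilon>"
    using N_bound(1) assms(2) by simp_all
  with N_bound(2) show ?thesis
    unfolding C_def by blast
qed

lemma mean_sq_unbounded:
  assumes "\<kappa> > 0"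
  shows "\<exists>\<tau>>0. K \<le> mean_sq \<kappa> \<tau> 0"
proof -
  define M where "M = max K 1"
  then have "1 / M > 0" by simp
  then obtain N \<tau> where "N > 0" "\<tau> > 0"
    and bound: "\<kappa> * (128 / harm N) + \<tau> * (8 * (\<Sum>k\<le>N. real (Suc k))) \<le> 1 / M"
    using trial_form_bound_le[OF assms] by metis
  have "M \<le> mean_sq \<kappa> \<tau> L" if "L > 0" for L
  proof -
    have "1 \<le> (\<kappa> * (128 / harm N) + \<tau> * (8 * (\<Sum>k\<le>N. real (Suc k)))) * mean_sq \<kappa> \<tau> L"
      by (rule mean_sq_mult_trial_form_ge) fact+
    also have "\<dots> \<le> 1 / M * mean_sq \<kappa> \<tau> L"
      using assms \<open>\<tau> > 0\<close> that
      by (intro mult_right_mono bound) (auto simp: mean_sq_def intro: sum_nonneg propagator_diag_nonneg)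
    finally show ?thesis
      using \<open>1 / M > 0\<close> by (simp add: field_simps)
  qed
  then have "\<forall>\<^sub>F L in sequentially. M \<le> mean_sq \<kappa> \<tau> L"
    using eventually_gt_at_top[of 0] by (rule eventually_mono[rotated])
  then have "M \<le> mean_sq \<kappa> \<tau> 0"
    using tendsto_lowerbound[OF mean_sq_tendsto[OF assms \<open>\<tau> > 0\<close>]] by simp
  with \<open>\<tau> > 0\<close> show ?thesis
    unfolding M_def by (intro exI[of _ \<tau>]) simp
qed

section \<open>Free energy\<close>

text \<open>The term \<open>n = 0\<close> vanishes since division by zero yields zero.\<close>

definition log_fps :: "nat \<Rightarrow> real fps" where
  "log_fps L = Abs_fps (\<lambda>n. fps_nth (trace_fps L) n / real n)"

definition free_energy :: "real \<Rightarrow> real \<Rightarrow> nat \<Rightarrow> real" where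
  "free_energy \<kappa> \<tau> L = ln (2 * pi) - ln (6 * \<kappa> + \<tau>) + eval_fps (log_fps L) (hopping_parameter \<kappa> \<tau>) / 2"

lemma abs_log_fps_nth_le: "\<bar>fps_nth (log_fps L) n\<bar> \<le> 2 * 6 ^ n"
proof (cases "n = 0")
  case False
  then have "\<bar>fps_nth (log_fps L) n\<bar> \<le> \<bar>fps_nth (trace_fps L) n\<bar>"
    by (simp add: log_fps_def divide_le_eq mult_le_cancel_left1)
  then show ?thesis
    using abs_trace_fps_nth_le[of L n] by linarith
qed (simp add: log_fps_def)

lemmas less_fps_conv_radius_log = less_fps_conv_radius_if_bounded[OF abs_log_fps_nth_le]

lemma log_fps_nth_eventually: "\<forall>\<^sub>F L in sequentially. fps_nth (log_fps L) n = fps_nth (log_fps 0) n"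
  using trace_fps_nth_eventually[of n] by eventually_elim (simp add: log_fps_def)

lemma eval_log_fps_tendsto:
  assumes "\<bar>v\<bar> < 1 / 6"
  shows "(\<lambda>L. eval_fps (log_fps L) v) \<longlonglongrightarrow> eval_fps (log_fps 0) v"
  by (rule tendsto_eval_fps[where C = 2 and R = 6])
     (use assms log_fps_nth_eventually abs_log_fps_nth_le in auto)

lemma fps_X_mult_deriv_log_fps: "fps_X * fps_deriv (log_fps L) = trace_fps L - fps_const 2"
proof (rule fps_ext)
  show "fps_nth (fps_X * fps_deriv (log_fps L)) n = fps_nth (trace_fps L - fps_const 2) n" for n
    by (cases n) (simp_all add: log_fps_def trace_fps_nth_0)
qed

lemma DERIV_eval_log_fps:
  assumes "v \<noteq> 0" "\<bar>v\<bar> < 1 / 6"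
  shows "(eval_fps (log_fps L) has_real_derivative (eval_fps (trace_fps L) v - 2) / v) (at v)"
proof -
  note radius = less_fps_conv_radius_log[OF assms(2), of L]
  have "v * eval_fps (fps_deriv (log_fps L)) v = eval_fps (fps_X * fps_deriv (log_fps L)) v"
    using radius fps_conv_radius_deriv[of "log_fps L"]
    by (subst eval_fps_mult) (auto intro: less_le_trans)
  also have "\<dots> = eval_fps (trace_fps L) v - 2"
    using less_fps_conv_radius_trace[OF assms(2), of L]
    by (simp add: fps_X_mult_deriv_log_fps eval_fps_diff)
  finally have "eval_fps (fps_deriv (log_fps L)) v = (eval_fps (trace_fps L) v - 2) / v"
    using assms(1) by (simp add: field_simps)
  then show ?thesis
    using has_field_derivative_eval_fps[OF radius] by metis
qed

lemma DERIV_hopping_parameter: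
  assumes "6 * \<kappa> + \<tau> \<noteq> 0"
  shows "(hopping_parameter \<kappa> has_real_derivative - hopping_parameter \<kappa> \<tau> / (6 * \<kappa> + \<tau>)) (at \<tau>)"
  unfolding hopping_parameter_def[abs_def]
  using assms by (auto intro!: derivative_eq_intros simp: power2_eq_square)

lemma DERIV_free_energy:
  assumes "\<kappa> > 0" "\<tau> > 0"
  shows "((\<lambda>\<tau>. free_energy \<kappa> \<tau> L) has_real_derivative - mean_sq \<kappa> \<tau> L / 2) (at \<tau>)"
proof -
  let ?T = "6 * \<kappa> + \<tau>" and ?v = "hopping_parameter \<kappa> \<tau>"
  let ?A = "eval_fps (trace_fps L) ?v"
  have T_pos: "?T > 0" and v_pos: "?v > 0"
    using assms hopping_parameter_pos by simp_all
  have "((\<lambda>\<tau>. eval_fps (log_fps L) (hopping_parameter \<kappa> \<tau>))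
      has_real_derivative (?A - 2) / ?v * (- ?v / ?T)) (at \<tau>)"
    using assms T_pos v_pos
    by (intro DERIV_chain2[OF DERIV_eval_log_fps DERIV_hopping_parameter]
        abs_hopping_parameter_less) auto
  moreover have "((\<lambda>\<tau>. ln (6 * \<kappa> + \<tau>)) has_real_derivative 1 / ?T) (at \<tau>)"
    using T_pos by (auto intro!: derivative_eq_intros)
  ultimately have "((\<lambda>\<tau>. free_energy \<kappa> \<tau> L)
      has_real_derivative 0 - 1 / ?T + (?A - 2) / ?v * (- ?v / ?T) / 2) (at \<tau>)"
    unfolding free_energy_def by (intro DERIV_add DERIV_diff DERIV_const DERIV_cdivide)
  moreover have "0 - 1 / t + (a - 2) / v * (- v / t) / 2 = - (a / t) / 2"
    if "v > 0" "t > 0" for a t v :: real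
    using that by (simp add: field_simps)
  from this[OF v_pos T_pos] have "0 - 1 / ?T + (?A - 2) / ?v * (- ?v / ?T) / 2 = - mean_sq \<kappa> \<tau> L / 2"
    unfolding mean_sq_eq_eval_fps[OF assms] .
  ultimately show ?thesis by simp
qed

lemma free_energy_tendsto:
  assumes "\<kappa> > 0" "\<tau> > 0"
  shows "free_energy \<kappa> \<tau> \<longlonglongrightarrow> free_energy \<kappa> \<tau> 0"
  unfolding free_energy_def[abs_def]
  by (intro tendsto_intros eval_log_fps_tendsto abs_hopping_parameter_less assms) simp

lemma ln_gauss_partition_supporting_line:
  assumes "L > 0" "\<kappa> > 0" "\<tau> > 0" "\<tau>' > 0"
  shows "- (real L ^ 3 * mean_sq \<kappa> \<tau> L / 2) * (\<tau>' - \<tau>)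
      \<le> ln (gauss_partition \<kappa> \<tau>' L) - ln (gauss_partition \<kappa> \<tau> L)"
proof -
  interpret P: prob_space "gauss_measure \<kappa> \<tau> L"
    by (rule prob_space_gauss_measure[OF assms(1-3)])
  note Z_pos = gauss_partition_pos[OF assms(1-3)] gauss_partition_pos[OF assms(1,2,4)]
  define X where "X S = - (\<tau>' - \<tau>) / 2 * constraint L S" for S
  have weight: "gauss_weight \<kappa> \<tau> L S * exp (X S) = gauss_weight \<kappa> \<tau>' L S" for S
    unfolding gauss_weight_def quad_form_def X_def constraint_eq_torus_inner[OF assms(1)]
    by (simp add: field_simps flip: exp_add)
  have X_mean: "has_bochner_integral (gauss_measure \<kappa> \<tau> L) X (- (\<tau>' - \<tau>) / 2 * (real L ^ 3 * mean_sq \<kappa> \<tau> L))"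
    unfolding X_def[abs_def] by (intro has_bochner_integral_mult_right constraint_moment assms)
  have "(\<lambda>S. exp (X S)) \<in> borel_measurable (config_measure L)"
    using borel_measurable_has_bochner_integral[OF X_mean]
    by (simp cong: measurable_cong_sets add: sets_gauss_measure)
  then have exp_X_mean: "has_bochner_integral (gauss_measure \<kappa> \<tau> L) (\<lambda>S. exp (X S))
      (gauss_partition \<kappa> \<tau>' L / gauss_partition \<kappa> \<tau> L)"
    using has_bochner_integral_gauss_weight[OF assms(1,2,4)] Z_pos
    by (intro has_bochner_integral_gauss_measure assms) (simp_all add: weight)
  have "exp (P.expectation X) \<le> P.expectation (\<lambda>S. exp (X S))"
    using X_mean exp_X_mean by (intro P.jensens_inequality[of X UNIV] exp_convex)
      (auto simp: has_bochner_integral_iff)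
  then have "exp (- (\<tau>' - \<tau>) / 2 * (real L ^ 3 * mean_sq \<kappa> \<tau> L))
      \<le> gauss_partition \<kappa> \<tau>' L / gauss_partition \<kappa> \<tau> L"
    using X_mean exp_X_mean by (simp add: has_bochner_integral_integral_eq)
  then have "- (\<tau>' - \<tau>) / 2 * (real L ^ 3 * mean_sq \<kappa> \<tau> L)
      \<le> ln (gauss_partition \<kappa> \<tau>' L / gauss_partition \<kappa> \<tau> L)"
    using Z_pos by (subst ln_ge_iff) simp_all
  then show ?thesis
    using Z_pos by (simp add: ln_div field_simps)
qed

lemma isCont_mean_sq:
  assumes "\<kappa> > 0" "\<tau> > 0"
  shows "isCont (\<lambda>\<tau>. mean_sq \<kappa> \<tau> L) \<tau>"
proof -
  have "isCont (eval_fps (trace_fps L)) (hopping_parameter \<kappa> \<tau>)"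
    by (intro continuous_eval_fps less_fps_conv_radius_trace abs_hopping_parameter_less assms)
  moreover have "isCont (hopping_parameter \<kappa>) \<tau>"
    using assms by (intro DERIV_isCont[OF DERIV_hopping_parameter]) simp
  ultimately have "isCont (\<lambda>\<tau>. eval_fps (trace_fps L) (hopping_parameter \<kappa> \<tau>)) \<tau>"
    by (rule isCont_o2[rotated])
  then have "isCont (\<lambda>\<tau>. eval_fps (trace_fps L) (hopping_parameter \<kappa> \<tau>) / (6 * \<kappa> + \<tau>)) \<tau>"
    using assms by (intro isCont_divide) auto
  moreover have "\<forall>\<^sub>F t in nhds \<tau>. t \<in> {0<..}"
    using assms by (intro eventually_nhds_in_open) auto
  then have "\<forall>\<^sub>F t in nhds \<tau>. mean_sq \<kappa> t L = eval_fps (trace_fps L) (hopping_parameter \<kappa> t)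
      / (6 * \<kappa> + t)"
    by eventually_elim (simp add: mean_sq_eq_eval_fps assms)
  ultimately show ?thesis
    by (simp add: isCont_cong)
qed

lemma DERIV_ln_gauss_partition:
  assumes "L > 0" "\<kappa> > 0" "\<tau> > 0"
  shows "((\<lambda>\<tau>. ln (gauss_partition \<kappa> \<tau> L)) has_real_derivative - (real L ^ 3 * mean_sq \<kappa> \<tau> L / 2))
      (at \<tau>)"
proof (rule DERIV_of_supporting_lines[where S = "{0<..}"])
  show "isCont (\<lambda>\<tau>. - (real L ^ 3 * mean_sq \<kappa> \<tau> L / 2)) \<tau>"
    by (intro continuous_intros isCont_mean_sq assms) simp
  show "- (real L ^ 3 * mean_sq \<kappa> x L / 2) * (y - x)
      \<le> ln (gauss_partition \<kappa> y L) - ln (gauss_partition \<kappa> x L)"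
    if "x \<in> {0<..}" "y \<in> {0<..}" for x y
    using ln_gauss_partition_supporting_line[OF assms(1,2)] that by simp
qed (use assms in auto)

lemma ln_gauss_partition_bounds:
  assumes "L > 0" "\<kappa> > 0" "\<tau> > 0"
  shows "ln (2 * pi) - ln (6 * \<kappa> + \<tau>) \<le> ln (gauss_partition \<kappa> \<tau> L) / real L ^ 3"
    "ln (gauss_partition \<kappa> \<tau> L) / real L ^ 3 \<le> ln (2 * pi) - ln \<tau>"
proof -
  have T_pos: "6 * \<kappa> + \<tau> > 0" using assms by simp
  have "ln ((2 * pi / (6 * \<kappa> + \<tau>)) ^ L ^ 3) \<le> ln (gauss_partition \<kappa> \<tau> L)"
    "ln (gauss_partition \<kappa> \<tau> L) \<le> ln ((2 * pi / \<tau>) ^ L ^ 3)"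
    using gauss_partition_bounds[OF assms] gauss_partition_pos[OF assms] T_pos assms(3)
    by (simp_all add: ln_mono)
  moreover have "ln ((2 * pi / t) ^ L ^ 3) = real L ^ 3 * (ln (2 * pi) - ln t)" if "t > 0" for t
    using that by (simp add: ln_realpow ln_div)
  ultimately show "ln (2 * pi) - ln (6 * \<kappa> + \<tau>) \<le> ln (gauss_partition \<kappa> \<tau> L) / real L ^ 3"
    "ln (gauss_partition \<kappa> \<tau> L) / real L ^ 3 \<le> ln (2 * pi) - ln \<tau>"
    using T_pos assms by (simp_all add: pos_le_divide_eq pos_divide_le_eq mult.commute)
qed

lemma free_energy_at_top:
  assumes "\<kappa> > 0"
  shows "((\<lambda>\<tau>. free_energy \<kappa> \<tau> L + ln (6 * \<kappa> + \<tau>)) \<longlongrightarrow> ln (2 * pi)) at_top"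
proof -
  have "isCont (eval_fps (log_fps L)) 0"
    by (intro continuous_eval_fps less_fps_conv_radius_log) simp
  moreover have "(hopping_parameter \<kappa> \<longlongrightarrow> 0) at_top"
    unfolding hopping_parameter_def[abs_def] by real_asymp
  ultimately have "((\<lambda>\<tau>. eval_fps (log_fps L) (hopping_parameter \<kappa> \<tau>)) \<longlongrightarrow> eval_fps (log_fps L) 0) at_top"
    by (rule isCont_tendsto_compose)
  then have "((\<lambda>\<tau>. ln (2 * pi) + eval_fps (log_fps L) (hopping_parameter \<kappa> \<tau>) / 2)
      \<longlongrightarrow> ln (2 * pi) + 0 / 2) at_top"
    by (intro tendsto_intros) (simp_all add: eval_fps_at_0 log_fps_def)
  then show ?thesis
    by (simp add: free_energy_def)
qed

lemma ln_gauss_partition_at_top: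
  assumes "L > 0" "\<kappa> > 0"
  shows "((\<lambda>\<tau>. ln (gauss_partition \<kappa> \<tau> L) / real L ^ 3 + ln (6 * \<kappa> + \<tau>)) \<longlongrightarrow> ln (2 * pi)) at_top"
proof (rule tendsto_sandwich[where f = "\<lambda>_. ln (2 * pi)"
      and h = "\<lambda>\<tau>. ln (2 * pi) - ln \<tau> + ln (6 * \<kappa> + \<tau>)"])
  show "((\<lambda>\<tau>. ln (2 * pi) - ln \<tau> + ln (6 * \<kappa> + \<tau>)) \<longlongrightarrow> ln (2 * pi)) at_top"
    by real_asymp
  show "\<forall>\<^sub>F \<tau> in at_top. ln (2 * pi) \<le> ln (gauss_partition \<kappa> \<tau> L) / real L ^ 3 + ln (6 * \<kappa> + \<tau>)"
    using eventually_gt_at_top[of 0]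
    by eventually_elim (use ln_gauss_partition_bounds(1)[OF assms] in \<open>simp add: diff_le_eq\<close>)
  show "\<forall>\<^sub>F \<tau> in at_top. ln (gauss_partition \<kappa> \<tau> L) / real L ^ 3 + ln (6 * \<kappa> + \<tau>)
      \<le> ln (2 * pi) - ln \<tau> + ln (6 * \<kappa> + \<tau>)"
    using eventually_gt_at_top[of 0]
    by eventually_elim (use ln_gauss_partition_bounds(2)[OF assms] in simp)
qed simp

text \<open>Both sides have the same \<open>\<tau>\<close>-derivative and the same asymptotics as \<open>\<tau> \<rightarrow> \<infinity>\<close>.\<close>

lemma ln_gauss_partition_eq_free_energy:
  assumes "L > 0" "\<kappa> > 0" "\<tau> > 0"
  shows "ln (gauss_partition \<kappa> \<tau> L) / real L ^ 3 = free_energy \<kappa> \<tau> L"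
proof -
  define D where "D t = ln (gauss_partition \<kappa> t L) / real L ^ 3 - free_energy \<kappa> t L" for t
  have "(D has_real_derivative 0) (at t)" if "t > 0" for t
    using DERIV_diff[OF DERIV_cdivide[OF DERIV_ln_gauss_partition[OF assms(1,2) that], of "real L ^ 3"]
        DERIV_free_energy[OF assms(2) that, of L]] assms(1)
    by (simp add: D_def[abs_def])
  then have "\<exists>c. \<forall>t\<in>{0<..}. D t = c"
    by (intro has_field_derivative_zero_constant) (auto intro: has_field_derivative_at_within)
  then obtain c where D_const: "\<And>t. t > 0 \<Longrightarrow> D t = c" by auto
  have "(D \<longlongrightarrow> ln (2 * pi) - ln (2 * pi)) at_top"
    using tendsto_diff[OF ln_gauss_partition_at_top[OF assms(1,2)]
        free_energy_at_top[OF assms(2), of L]]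
    by (simp add: D_def[abs_def])
  moreover have "\<forall>\<^sub>F t in at_top. D t = c"
    using eventually_gt_at_top[of "0::real"] by eventually_elim (rule D_const)
  then have "(D \<longlongrightarrow> c) at_top"
    by (rule tendsto_eventually)
  ultimately have "c = 0"
    using tendsto_unique trivial_limit_at_top_linorder by fastforce
  then show ?thesis
    using D_const[OF assms(3)] by (simp add: D_def)
qed

section \<open>The critical chemical potential\<close>

definition spin_density :: "real \<Rightarrow> real" where
  "spin_density = eval_fps (fps_X * trace_fps 0)"

definition spin_density_inv :: "real \<Rightarrow> real" where
  "spin_density_inv = the_inv_into {0<..<1/6} spin_density"

definition critical_potential :: "real \<Rightarrow> real" where
  "critical_potential \<kappa> = (\<kappa> / spin_density_inv \<kappa> - 6 * \<kappa>) / 2"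

lemma abs_fps_X_mult_trace_fps_nth_le: "\<bar>fps_nth (fps_X * trace_fps L) n\<bar> \<le> 2 * 6 ^ n"
proof (cases n)
  case (Suc m)
  then show ?thesis
    using abs_trace_fps_nth_le[of L m] by simp
qed simp

lemmas less_fps_conv_radius_spin_density
    = less_fps_conv_radius_if_bounded[OF abs_fps_X_mult_trace_fps_nth_le]

lemma mean_sq_eq_spin_density:
  assumes "\<kappa> > 0" "\<tau> > 0"
  shows "mean_sq \<kappa> \<tau> 0 = spin_density (hopping_parameter \<kappa> \<tau>) / \<kappa>"
proof -
  have "norm (hopping_parameter \<kappa> \<tau>) < fps_conv_radius (trace_fps 0)"
    by (intro less_fps_conv_radius_trace abs_hopping_parameter_less assms)
  then show ?thesis
    using assms by (simp add: spin_density_def mean_sq_eq_eval_fps eval_fps_mult)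
        (simp add: hopping_parameter_def)
qed

lemma DERIV_spin_density_pos:
  assumes "0 \<le> v" "v < 1 / 6"
  shows "\<exists>D>0. (spin_density has_real_derivative D) (at v)"
proof (intro exI conjI)
  let ?F = "fps_X * trace_fps 0"
  have radius: "norm v < fps_conv_radius ?F"
    using assms by (intro less_fps_conv_radius_spin_density) simp
  then show "(spin_density has_real_derivative eval_fps (fps_deriv ?F) v) (at v)"
    unfolding spin_density_def by (rule has_field_derivative_eval_fps)
  have "fps_nth (fps_deriv ?F) 0 \<le> eval_fps (fps_deriv ?F) v"
  proof (rule eval_fps_ge_nth_0)
    show "norm v < fps_conv_radius (fps_deriv ?F)"
      using radius fps_conv_radius_deriv[of ?F] by (rule less_le_trans)
  qed (use assms(1) trace_fps_nth_nonneg in simp_all)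
  then show "0 < eval_fps (fps_deriv ?F) v"
    by (simp add: trace_fps_nth_0)
qed

lemma spin_density_less:
  assumes "0 \<le> u" "u < v" "v < 1 / 6"
  shows "spin_density u < spin_density v"
proof (rule DERIV_pos_imp_increasing[OF assms(2)])
  fix x assume "u \<le> x" "x \<le> v"
  then obtain D where "D > 0" "(spin_density has_real_derivative D) (at x)"
    using DERIV_spin_density_pos[of x] assms by auto
  then show "\<exists>D. (spin_density has_real_derivative D) (at x) \<and> D > 0"
    by blast
qed

lemma isCont_spin_density: "0 \<le> v \<Longrightarrow> v < 1 / 6 \<Longrightarrow> isCont spin_density v"
  using DERIV_spin_density_pos DERIV_isCont by blast

lemma spin_density_0: "spin_density 0 = 0"
  by (simp add: spin_density_def eval_fps_at_0)

lemma bij_betw_spin_density: "bij_betw spin_density {0<..<1/6} {0<..}"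
proof (intro bij_betw_imageI subset_antisym)
  have "strict_mono_on {0<..<1/6} spin_density"
    by (rule strict_mono_onI) (simp add: spin_density_less)
  then show "inj_on spin_density {0<..<1/6}"
    by (rule strict_mono_on_imp_inj_on)
  show "spin_density ` {0<..<1/6} \<subseteq> {0<..}"
    using spin_density_less[of 0] by (auto simp: spin_density_0)
  show "{0<..} \<subseteq> spin_density ` {0<..<1/6}"
  proof
    fix y :: real assume "y \<in> {0<..}"
    then have y_pos: "0 < y" by simp
    obtain \<tau> where \<tau>_bound: "\<tau> > 0" "y \<le> mean_sq 1 \<tau> 0"
      using mean_sq_unbounded[of 1 y] by auto
    define b where "b = hopping_parameter 1 \<tau>"
    have b_range: "0 < b" "b < 1 / 6"
      using \<tau>_bound(1) hopping_parameter_pos[of 1 \<tau>] abs_hopping_parameter_less[of 1 \<tau>] by (auto simp: b_def)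
    have "y \<le> spin_density b"
      using \<tau>_bound mean_sq_eq_spin_density[of 1 \<tau>] by (simp add: b_def)
    moreover have "isCont spin_density v" if "0 \<le> v" "v \<le> b" for v
      using that b_range by (intro isCont_spin_density) auto
    ultimately obtain v where v_range: "0 \<le> v" "v \<le> b" "spin_density v = y"
      using IVT[of spin_density 0 y b] b_range y_pos by (auto simp: spin_density_0)
    moreover have "v \<noteq> 0"
      using v_range y_pos by (auto simp: spin_density_0)
    ultimately show "y \<in> spin_density ` {0<..<1/6}"
      using b_range by auto
  qed
qed

context
  fixes \<kappa> :: real
  assumes \<kappa>_pos: "\<kappa> > 0"
begin

lemma spin_density_inv_bounds: "0 < spin_density_inv \<kappa>" "spin_density_inv \<kappa> < 1 / 6"
  using bij_betwE[OF bij_betw_the_inv_into[OF bij_betw_spin_density]] \<kappa>_pos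
  by (auto simp: spin_density_inv_def)

lemma spin_density_spin_density_inv: "spin_density (spin_density_inv \<kappa>) = \<kappa>"
  unfolding spin_density_inv_def using bij_betw_spin_density \<kappa>_pos
  by (intro f_the_inv_into_f_bij_betw) auto

lemma critical_potential_pos: "critical_potential \<kappa> > 0"
  using spin_density_inv_bounds \<kappa>_pos by (simp add: critical_potential_def field_simps)

lemma critical_hopping_parameter: "hopping_parameter \<kappa> (2 * critical_potential \<kappa>) = spin_density_inv \<kappa>"
proof -
  have "2 * critical_potential \<kappa> = \<kappa> / spin_density_inv \<kappa> - 6 * \<kappa>"
    by (simp add: critical_potential_def)
  then have "6 * \<kappa> + 2 * critical_potential \<kappa> = \<kappa> / spin_density_inv \<kappa>"
    by linarith
  then show ?thesis
    using \<kappa>_pos by (simp add: hopping_parameter_def)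
qed

lemma mean_sq_critical_potential: "mean_sq \<kappa> (2 * critical_potential \<kappa>) 0 = 1"
  using mean_sq_eq_spin_density[of \<kappa> "2 * critical_potential \<kappa>"] critical_potential_pos \<kappa>_pos
  by (simp add: critical_hopping_parameter spin_density_spin_density_inv)

lemma isCont_spin_density_inv: "isCont spin_density_inv \<kappa>"
proof -
  define v where "v = spin_density_inv \<kappa>"
  have v_range: "0 < v" "v < 1 / 6" "spin_density v = \<kappa>"
    using spin_density_inv_bounds spin_density_spin_density_inv by (simp_all add: v_def)
  have "isCont spin_density_inv (spin_density v)"
  proof (rule isCont_inverse_function2[where f = spin_density and x = v])
    show "v / 2 < v" "v < (v + 1 / 6) / 2"
      using v_range by auto
    fix u assume u_range: "v / 2 \<le> u" "u \<le> (v + 1 / 6) / 2"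
    with v_range have "0 < u" "u < 1 / 6"
      by auto
    then show "spin_density_inv (spin_density u) = u" "isCont spin_density u"
      unfolding spin_density_inv_def using bij_betw_imp_inj_on[OF bij_betw_spin_density]
      by (auto intro: the_inv_into_f_f isCont_spin_density)
  qed
  then show ?thesis
    by (simp add: v_range)
qed

end

lemma real_analytic_at_spin_density_inv:
  assumes "\<kappa> > 0"
  shows "real_analytic_at spin_density_inv \<kappa>"
proof -
  define v where "v = spin_density_inv \<kappa>"
  have v_range: "0 < v" "v < 1 / 6" "spin_density v = \<kappa>"
    using spin_density_inv_bounds[OF assms] spin_density_spin_density_inv[OF assms]
    by (simp_all add: v_def)
  have "\<forall>\<^sub>F y in nhds \<kappa>. y \<in> {0<..}"
    using assms by (intro eventually_nhds_in_open) auto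
  then have right_inverse: "\<forall>\<^sub>F y in nhds \<kappa>. spin_density (spin_density_inv y) = y"
    by eventually_elim (simp add: spin_density_spin_density_inv)
  obtain D where D_pos: "D > 0" "(spin_density has_real_derivative D) (at v)"
    using DERIV_spin_density_pos[of v] v_range by auto
  have "real_analytic_at spin_density v"
    unfolding spin_density_def
    by (intro real_analytic_at_eval_fps less_fps_conv_radius_spin_density) (use v_range in simp)
  then have "real_analytic_at spin_density_inv (spin_density v)"
    using D_pos isCont_spin_density_inv[OF assms] right_inverse
    by (intro real_analytic_at_inverse_function[of spin_density v D])
        (simp_all add: v_range(3), simp add: v_def)
  then show ?thesis
    by (simp add: v_range)
qed

lemma real_analytic_at_critical_potential:
  assumes "\<kappa> > 0"
  shows "real_analytic_at critical_potential \<kappa>"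
  unfolding critical_potential_def[abs_def]
  by (intro real_analytic_at_divide real_analytic_at_diff real_analytic_at_mult real_analytic_at_ident
      real_analytic_at_const real_analytic_at_spin_density_inv assms)
     (use spin_density_inv_bounds[OF assms] in auto)

lemma real_analytic_at_critical_free_energy:
  assumes "\<kappa> > 0"
  shows "real_analytic_at (\<lambda>\<kappa>. free_energy \<kappa> (2 * critical_potential \<kappa>) 0) \<kappa>"
proof -
  let ?T = "\<lambda>\<kappa>. 6 * \<kappa> + 2 * critical_potential \<kappa>"
  have T_pos: "?T \<kappa> > 0"
    using assms critical_potential_pos[OF assms] by simp
  have T_analytic: "real_analytic_at ?T \<kappa>"
    by (intro real_analytic_at_add real_analytic_at_mult real_analytic_at_ident real_analytic_at_const
        real_analytic_at_critical_potential assms)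
  have "real_analytic_at (\<lambda>\<kappa>. ln (?T \<kappa>)) \<kappa>"
    by (rule real_analytic_at_compose[OF T_analytic real_analytic_at_ln[OF T_pos]])
  moreover have "real_analytic_at (\<lambda>\<kappa>. hopping_parameter \<kappa> (2 * critical_potential \<kappa>)) \<kappa>"
    unfolding hopping_parameter_def using T_pos
    by (intro real_analytic_at_divide real_analytic_at_ident T_analytic) simp
  then have "real_analytic_at (\<lambda>\<kappa>. eval_fps (log_fps 0)
      (hopping_parameter \<kappa> (2 * critical_potential \<kappa>))) \<kappa>"
    by (rule real_analytic_at_compose)
       (intro real_analytic_at_eval_fps less_fps_conv_radius_log abs_hopping_parameter_less assms,
        simp add: critical_potential_pos assms)
  ultimately show ?thesis
    unfolding free_energy_def
    by (intro real_analytic_at_add real_analytic_at_diff real_analytic_at_divide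
        real_analytic_at_const) auto
qed

section \<open>Infinite-volume limits\<close>

lemma euclid_dist3_le_lattice_norm: "euclid_dist3 r r' \<le> 2 * real_of_int (lattice_norm (r - r'))"
proof -
  obtain a b c a' b' c' where coordinates: "r = (a, b, c)" "r' = (a', b', c')"
    by (metis prod_cases3)
  let ?s = "lattice_norm (r - r')"
  have "\<bar>a - a'\<bar> \<le> ?s" "\<bar>b - b'\<bar> \<le> ?s" "\<bar>c - c'\<bar> \<le> ?s"
    by (simp_all add: lattice_norm_def coordinates)
  moreover have "x\<^sup>2 \<le> ?s\<^sup>2" if "\<bar>x\<bar> \<le> ?s" for x
    using power_mono[OF that abs_ge_zero, of 2] by simp
  ultimately have "(a - a')\<^sup>2 \<le> ?s\<^sup>2" "(b - b')\<^sup>2 \<le> ?s\<^sup>2" "(c - c')\<^sup>2 \<le> ?s\<^sup>2"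
    by blast+
  then have "(a - a')\<^sup>2 + (b - b')\<^sup>2 + (c - c')\<^sup>2 \<le> 4 * ?s\<^sup>2"
    using zero_le_power2[of ?s] by linarith
  also have "\<dots> = (2 * ?s)\<^sup>2"
    by (simp add: power_mult_distrib)
  finally have "real_of_int ((a - a')\<^sup>2 + (b - b')\<^sup>2 + (c - c')\<^sup>2) \<le> (2 * real_of_int ?s)\<^sup>2"
    by (metis of_int_le_iff of_int_mult of_int_numeral of_int_power)
  then show ?thesis
    unfolding euclid_dist3_def coordinates prod.case by (intro real_le_lsqrt) (simp_all add: lattice_norm_nonneg)
qed

lemma propagator_decay:
  assumes "\<kappa> > 0" "\<tau> > 0" "\<epsilon> > 0"
  shows "\<exists>R. \<forall>r r'. R \<le> euclid_dist3 r r' \<longrightarrow> \<bar>propagator \<kappa> \<tau> 0 w (r - r') \<bullet> w'\<bar> < \<epsilon>"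
proof -
  let ?q = "6 * hopping_parameter \<kappa> \<tau>" and ?C = "norm w * norm w' / \<tau>"
  have "(\<lambda>n. ?C * ?q ^ n) \<longlonglongrightarrow> ?C * 0"
    using abs_hopping_parameter_less[OF assms(1,2)]
    by (intro tendsto_mult tendsto_const LIMSEQ_power_zero) simp
  then have "\<forall>\<^sub>F n in sequentially. ?C * ?q ^ n < \<epsilon>"
    by (rule order_tendstoD) (use assms in simp)
  then obtain N where N_bound: "\<And>n. n \<ge> N \<Longrightarrow> ?C * ?q ^ n < \<epsilon>"
    unfolding eventually_sequentially by blast
  have "\<bar>propagator \<kappa> \<tau> 0 w (r - r') \<bullet> w'\<bar> < \<epsilon>" if "2 * real N \<le> euclid_dist3 r r'" for r r'
  proof -
    have "real N \<le> real_of_int (lattice_norm (r - r'))"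
      using that euclid_dist3_le_lattice_norm[of r r'] by simp
    then have "N \<le> nat (lattice_norm (r - r'))"
      by linarith
    then show ?thesis
      by (rule le_less_trans[OF abs_propagator_le[OF assms(1,2)] N_bound])
  qed
  then show ?thesis by blast
qed

context
  fixes J \<beta> \<mu> :: real
  assumes coupling_pos: "\<beta> * J > 0" and mass_pos: "2 * \<mu> > 0"
begin

lemma gibbs_expect_tendsto:
  assumes "\<And>L. L > 0 \<Longrightarrow> has_bochner_integral (gauss_measure (\<beta> * J) (2 * \<mu>) L) (F L) (x L)"
    and "x \<longlonglongrightarrow> y"
  shows "(\<lambda>L. gibbs_expect J L \<beta> \<mu> (F L)) \<longlonglongrightarrow> y"
proof (rule Lim_transform_eventually[OF assms(2)])
  show "\<forall>\<^sub>F L in sequentially. x L = gibbs_expect J L \<beta> \<mu> (F L)"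
    using eventually_gt_at_top[of 0]
    by eventually_elim (intro gibbs_expectation[symmetric] assms coupling_pos mass_pos)
qed

lemma constraint_density_tendsto:
  "(\<lambda>L. gibbs_expect J L \<beta> \<mu> (constraint L) / real L ^ 3) \<longlonglongrightarrow> mean_sq (\<beta> * J) (2 * \<mu>) 0"
proof (rule Lim_transform_eventually[OF mean_sq_tendsto[OF coupling_pos mass_pos]])
  show "\<forall>\<^sub>F L in sequentially. mean_sq (\<beta> * J) (2 * \<mu>) L
      = gibbs_expect J L \<beta> \<mu> (constraint L) / real L ^ 3"
    using eventually_gt_at_top[of 0]
  proof eventually_elim
    case (elim L)
    then show ?case
      using gibbs_expectation[OF elim coupling_pos mass_pos
          constraint_moment[OF elim coupling_pos mass_pos]] by simp
  qed
qed

lemma mean_spin_tendsto: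
  "(\<lambda>L. gibbs_expect J L \<beta> \<mu> (\<lambda>S. (norm ((1 / real L ^ 3) *\<^sub>R (\<Sum>r\<in>sites L. S r)))\<^sup>2)) \<longlonglongrightarrow> 0"
proof (rule gibbs_expect_tendsto[where x = "\<lambda>L. 1 / \<mu> / real L ^ 3"])
  show "(\<lambda>L. 1 / \<mu> / real L ^ 3) \<longlonglongrightarrow> 0"
    by real_asymp
  fix L :: nat assume L_pos: "L > 0"
  have "has_bochner_integral (gauss_measure (\<beta> * J) (2 * \<mu>) L)
      (\<lambda>S. (norm ((1 / real L ^ 3) *\<^sub>R (\<Sum>r\<in>sites L. S r)))\<^sup>2)
          ((1 / real L ^ 3)\<^sup>2 * (2 * real L ^ 3 / (2 * \<mu>)))"
    unfolding norm_scaleR power_mult_distrib real_norm_def power2_abs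
    by (intro has_bochner_integral_mult_right total_spin_moment L_pos coupling_pos mass_pos)
  moreover have "(1 / l)\<^sup>2 * (2 * l / (2 * \<mu>)) = 1 / \<mu> / l" if "l \<noteq> 0" for l
    using that mass_pos by (simp add: power2_eq_square field_simps)
  then have "(1 / real L ^ 3)\<^sup>2 * (2 * real L ^ 3 / (2 * \<mu>)) = 1 / \<mu> / real L ^ 3"
    using L_pos by simp
  ultimately show "has_bochner_integral (gauss_measure (\<beta> * J) (2 * \<mu>) L)
      (\<lambda>S. (norm ((1 / real L ^ 3) *\<^sub>R (\<Sum>r\<in>sites L. S r)))\<^sup>2) (1 / \<mu> / real L ^ 3)"
    by (simp only:)
qed

lemma correlation_tendsto:
  "(\<lambda>L. gibbs_expect J L \<beta> \<mu> (\<lambda>S. (S (site_of L r) \<bullet> w) * (S (site_of L r') \<bullet> w')))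
    \<longlonglongrightarrow> propagator (\<beta> * J) (2 * \<mu>) 0 w' (r - r') \<bullet> w"
  by (rule gibbs_expect_tendsto[OF covariance[unfolded spin_field_def] propagator_tendsto])
     (use coupling_pos mass_pos in auto)

lemma ln_partition_fn_tendsto:
  "(\<lambda>L. ln (partition_fn J L \<beta> \<mu>) / real L ^ 3) \<longlonglongrightarrow> free_energy (\<beta> * J) (2 * \<mu>) 0"
proof (rule Lim_transform_eventually[OF free_energy_tendsto[OF coupling_pos mass_pos]])
  show "\<forall>\<^sub>F L in sequentially. free_energy (\<beta> * J) (2 * \<mu>) L = ln (partition_fn J L \<beta> \<mu>) / real L ^ 3"
    using eventually_gt_at_top[of 0]
    by eventually_elim (simp add: partition_fn_eq ln_gauss_partition_eq_free_energy coupling_pos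
        mass_pos)
qed

lemma component_correlations_decay:
  assumes "p \<in> {fst, snd}" "q \<in> {fst, snd}"
  shows "\<exists>g. (\<forall>r r'. (\<lambda>L. gibbs_expect J L \<beta> \<mu> (\<lambda>S. p (S (site_of L r)) * q (S (site_of L r'))))
      \<longlonglongrightarrow> g r r') \<and>
    (\<forall>\<epsilon>>0. \<exists>R. \<forall>r r'. euclid_dist3 r r' \<ge> R \<longrightarrow> \<bar>g r r'\<bar> < \<epsilon>)"
proof -
  have component: "\<exists>w. p = (\<lambda>x. x \<bullet> w)" if "p \<in> {fst, snd}" for p :: "real \<times> real \<Rightarrow> real"
  proof -
    have "fst = (\<lambda>x::real \<times> real. x \<bullet> (1, 0))" "snd = (\<lambda>x::real \<times> real. x \<bullet> (0, 1))"
      by (auto simp: inner_prod_def)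
    with that show ?thesis by blast
  qed
  obtain w w' where "p = (\<lambda>x. x \<bullet> w)" "q = (\<lambda>x. x \<bullet> w')"
    using component assms by metis
  then show ?thesis
    using correlation_tendsto propagator_decay[OF coupling_pos mass_pos]
    by (intro exI[of _ "\<lambda>r r'. propagator (\<beta> * J) (2 * \<mu>) 0 w' (r - r') \<bullet> w"]) simp
qed

end

theorem theorem7p1:
  fixes J :: real
  assumes "J > 0"
  shows "\<exists>\<mu>\<^sub>s :: real \<Rightarrow> real.
    real_analytic_on \<mu>\<^sub>s {0<..} \<and> (\<forall>\<beta>>0. \<mu>\<^sub>s \<beta> > 0) \<and>
    (\<forall>\<beta>>0.
       ((\<lambda>L. gibbs_expect J L \<beta> (\<mu>\<^sub>s \<beta>) (constraint L) / real L ^ 3) \<longlonglongrightarrow> 1) \<and>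
       ((\<lambda>L. gibbs_expect J L \<beta> (\<mu>\<^sub>s \<beta>)
           (\<lambda>S. (norm ((1 / real L ^ 3) *\<^sub>R (\<Sum>r\<in>sites L. S r)))^2)) \<longlonglongrightarrow> 0) \<and>
       (\<forall>p\<in>{fst, snd}. \<forall>q\<in>{fst, snd}. \<exists>g :: int \<times> int \<times> int \<Rightarrow> int \<times> int \<times> int \<Rightarrow> real.
          (\<forall>r r'. (\<lambda>L. gibbs_expect J L \<beta> (\<mu>\<^sub>s \<beta>)
                      (\<lambda>S. p (S (site_of L r)) * q (S (site_of L r')))) \<longlonglongrightarrow> g r r') \<and>
          (\<forall>\<epsilon>>0. \<exists>R. \<forall>r r'. euclid_dist3 r r' \<ge> R \<longrightarrow> \<bar>g r r'\<bar> < \<epsilon>))) \<and>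
    (\<exists>F :: real \<Rightarrow> real. real_analytic_on F {0<..} \<and>
       (\<forall>\<beta>>0. (\<lambda>L. ln (partition_fn J L \<beta> (\<mu>\<^sub>s \<beta>)) / real L ^ 3) \<longlonglongrightarrow> F \<beta>))"
proof -
  let ?\<mu> = "\<lambda>\<beta>. critical_potential (\<beta> * J)"
  let ?F = "\<lambda>\<beta>. free_energy (\<beta> * J) (2 * critical_potential (\<beta> * J)) 0"
  have coupling_pos: "\<beta> * J > 0" if "\<beta> > 0" for \<beta>
    using that assms by simp
  then have mass_pos: "2 * ?\<mu> \<beta> > 0" if "\<beta> > 0" for \<beta>
    using critical_potential_pos[of "\<beta> * J"] that by simp
  have coupling_analytic: "real_analytic_at (\<lambda>\<beta>. \<beta> * J) \<beta>" for \<beta>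
    by (intro real_analytic_at_mult real_analytic_at_ident real_analytic_at_const)
  have \<mu>_analytic: "real_analytic_on ?\<mu> {0<..}"
    by (intro real_analytic_on_if_at real_analytic_at_compose[OF coupling_analytic]
        real_analytic_at_critical_potential coupling_pos) simp
  have "real_analytic_on ?F {0<..}"
    by (intro real_analytic_on_if_at real_analytic_at_compose[OF coupling_analytic]
        real_analytic_at_critical_free_energy coupling_pos) simp
  then have free_energy: "\<exists>F. real_analytic_on F {0<..} \<and>
      (\<forall>\<beta>>0. (\<lambda>L. ln (partition_fn J L \<beta> (?\<mu> \<beta>)) / real L ^ 3) \<longlonglongrightarrow> F \<beta>)"
    using ln_partition_fn_tendsto[OF coupling_pos mass_pos] by (intro exI[of _ ?F]) simp
  have constraint: "(\<lambda>L. gibbs_expect J L \<beta> (?\<mu> \<beta>) (constraint L) / real L ^ 3) \<longlonglongrightarrow> 1" if "\<beta> > 0" for \<beta>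
    using constraint_density_tendsto[OF coupling_pos mass_pos, OF that that]
    by (simp add: mean_sq_critical_potential coupling_pos that)
  show ?thesis
    by (rule exI[of _ ?\<mu>], intro conjI allI impI ballI)
       (rule \<mu>_analytic critical_potential_pos[OF coupling_pos] constraint
          mean_spin_tendsto[OF coupling_pos mass_pos]
          component_correlations_decay[OF coupling_pos mass_pos] free_energy | assumption)+
qed

end
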